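(* Let $V$ satisfy Assumption (A) of the context. Let $\mathcal{S}_{\mathrm{ext}}$ be the family of stationary measures for the gradient dynamics $$d\eta_t(b)=-\nabla U_\cdot(\eta_t)(b)\,dt+\sqrt2\,d\nabla w_t(b),\quad b\in(\mathbb{Z}^d)^*,$$ which are tempered, translation invariant and ergodic under spatial shifts. Then the variances of $\eta(b)$ under $\mu\in\mathcal{S}_{\mathrm{ext}}$ are bounded from above by a constant independent of $\mu$, that is, $$\sup_{\mu\in\mathcal{S}_{\mathrm{ext}}}\mathrm{Var}_\mu[\eta(b)]<\infty,\quad b\in(\mathbb{Z}^d)^*.$$
   Context: **Assumption (A).** $V=V_0+g$ with $V_0,g\in C^2(\mathbb{R})$ symmetric (even), $c_-\le V_0''\le c_+$ on $\mathbb{R}$ for some constants $c_\pm>0$, and $|g'(\eta)|+|g''(\eta)|\le C_g$ for all $\eta\in\mathbb{R}$, for some constant $C_g>0$. **Notation.** $(\mathbb{Z}^d)^*$ is the set of directed bonds $b=(x,y)$, $x,y\in\mathbb{Z}^d$, $|x-y|=1$; $x_b=x$, $y_b=y$. For $\phi\in\mathbb{R}^{\mathbb{Z}^d}$, $\nabla\phi(b)=\phi(x)-\phi(y)$ for $b=(x,y)$. $\mathcal{X}=\{\nabla\phi:\phi\in\mathbb{R}^{\mathbb{Z}^d}\}\subset\mathbb{R}^{(\mathbb{Z}^d)^*}$. For $\eta\in\mathcal{X}$, $U_x(\eta)=\sum_{b:x_b=x}V'(\eta(b))$ and $\nabla U_\cdot(\eta)(b)=U_{x_b}(\eta)-U_{y_b}(\eta)$.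 $\{w_t(x);x\in\mathbb{Z}^d\}$ are independent one-dimensional standard Brownian motions and $\nabla w_t(b)=w_t(x_b)-w_t(y_b)$. For $r>0$, $\mathcal{X}_r=\{\eta\in\mathcal{X}:\sum_b|\eta(b)|^2e^{-2r|x_b|}<\infty\}$; the SDE has a unique strong solution in $\mathcal{X}_r$ for every $r>0$. A probability measure $\mu$ on $\mathcal{X}$ is tempered if $E^\mu[|\eta(b)|^2]<\infty$ for every $b$. It is stationary if the solution started from the initial law $\mu$ has law $\mu$ at every time $t\ge0$. *)

theory Defs
  imports "HOL-Probability.Probability"
begin

type_synonym 'd site = "int ^ 'd"
type_synonym 'd bond = "'d site \<times> 'd site"

(* Fields of bond variables are functions on all pairs of sites that are extensional on bonds
   (equal to undefined off bonds), so that they are points of the product space over bonds. *)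
type_synonym 'd bond_field = "'d bond \<Rightarrow> real"

definition site_norm :: "'d::finite site \<Rightarrow> real" where
  "site_norm x = norm (\<chi> i. real_of_int (x $ i))"

definition bonds :: "'d::finite bond set" where
  "bonds = {(x, y). site_norm (x - y) = 1}"

definition grad :: "('d::finite site \<Rightarrow> real) \<Rightarrow> 'd bond_field" where
  "grad \<phi> = (\<lambda>b\<in>bonds. \<phi> (fst b) - \<phi> (snd b))"

definition gradient_fields :: "'d::finite bond_field set" where
  "gradient_fields = range grad"

definition gradient_space :: "'d::finite bond_field measure" where
  "gradient_space = restrict_space (\<Pi>\<^sub>M b\<in>bonds. borel) gradient_fields"

definition weighted_fields :: "real \<Rightarrow> 'd::finite bond_field set" where
  "weighted_fields r = {\<eta> \<in> gradient_fields.
     (\<lambda>b. \<bar>\<eta> b\<bar>\<^sup>2 * exp (- 2 * r * site_norm (fst b))) summable_on bonds}"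

definition weighted_dist :: "real \<Rightarrow> 'd::finite bond_field \<Rightarrow> 'd bond_field \<Rightarrow> real" where
  "weighted_dist r \<eta> \<zeta> =
     sqrt (\<Sum>\<^sub>\<infinity>b\<in>bonds. \<bar>\<eta> b - \<zeta> b\<bar>\<^sup>2 * exp (- 2 * r * site_norm (fst b)))"

definition C2 :: "(real \<Rightarrow> real) \<Rightarrow> bool" where
  "C2 f \<longleftrightarrow> (\<forall>x. f field_differentiable at x) \<and> (\<forall>x. deriv f field_differentiable at x)
     \<and> continuous_on UNIV (deriv (deriv f))"

definition assumption_A :: "(real \<Rightarrow> real) \<Rightarrow> bool" where
  "assumption_A V \<longleftrightarrow> (\<exists>V\<^sub>0 g c_minus c_plus C_g.
     V = (\<lambda>u. V\<^sub>0 u + g u) \<and> C2 V\<^sub>0 \<and> C2 g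
     \<and> (\<forall>u. V\<^sub>0 (- u) = V\<^sub>0 u) \<and> (\<forall>u. g (- u) = g u)
     \<and> c_minus > 0 \<and> c_plus > 0
     \<and> (\<forall>u. c_minus \<le> deriv (deriv V\<^sub>0) u \<and> deriv (deriv V\<^sub>0) u \<le> c_plus)
     \<and> C_g > 0 \<and> (\<forall>u. \<bar>deriv g u\<bar> + \<bar>deriv (deriv g) u\<bar> \<le> C_g))"

definition site_force :: "(real \<Rightarrow> real) \<Rightarrow> 'd::finite bond_field \<Rightarrow> 'd site \<Rightarrow> real" where
  "site_force V \<eta> x = (\<Sum>b\<in>{b\<in>bonds. fst b = x}. deriv V (\<eta> b))"

definition standard_brownian_motion :: "'w measure \<Rightarrow> (real \<Rightarrow> 'w \<Rightarrow> real) \<Rightarrow> bool" where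
  "standard_brownian_motion M W \<longleftrightarrow> prob_space M
     \<and> (\<forall>t\<ge>0. W t \<in> borel_measurable M)
     \<and> (AE \<omega> in M. W 0 \<omega> = 0 \<and> continuous_on {0..} (\<lambda>t. W t \<omega>))
     \<and> (\<forall>s t. 0 \<le> s \<and> s < t \<longrightarrow>
          distributed M lborel (\<lambda>\<omega>. W t \<omega> - W s \<omega>) (normal_density 0 (sqrt (t - s))))
     \<and> (\<forall>(n::nat) \<tau>. 0 \<le> \<tau> 0 \<and> mono \<tau> \<longrightarrow>
          prob_space.indep_vars M (\<lambda>_. borel)
            (\<lambda>i \<omega>. W (\<tau> (Suc i)) \<omega> - W (\<tau> i) \<omega>) {..<n})"

definition brownian_family ::
    "'w measure \<Rightarrow> (real \<Rightarrow> 'd::finite site \<Rightarrow> 'w \<Rightarrow> real) \<Rightarrow> bool" where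
  "brownian_family M w \<longleftrightarrow> prob_space M
     \<and> (\<forall>x. standard_brownian_motion M (\<lambda>t. w t x))
     \<and> prob_space.indep_vars M (\<lambda>_. \<Pi>\<^sub>M t\<in>{0..}. borel) (\<lambda>x \<omega>. \<lambda>t\<in>{0..}. w t x \<omega>) UNIV"

(* Solution, continuous in the weighted l2 norm with exponent r, of the SDE in integrated form; the
   noise is additive, so no stochastic integral is needed. The initial value is independent of
   the noise. Adaptedness is then automatic: V' is Lipschitz under assumption_A, so the equation
   is uniquely solvable path by path and each \<eta> t is a functional of \<eta> 0 and of w up to time t. *)
definition gradient_sde_solution :: "(real \<Rightarrow> real) \<Rightarrow> real \<Rightarrow> 'w measure \<Rightarrow>
    (real \<Rightarrow> 'd::finite site \<Rightarrow> 'w \<Rightarrow> real) \<Rightarrow> (real \<Rightarrow> 'w \<Rightarrow> 'd bond_field) \<Rightarrow> bool" where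
  "gradient_sde_solution V r M w \<eta> \<longleftrightarrow> brownian_family M w
     \<and> (\<forall>t\<ge>0. \<eta> t \<in> M \<rightarrow>\<^sub>M gradient_space)
     \<and> prob_space.indep_set M
          (sets (vimage_algebra (space M) (\<eta> 0) gradient_space))
          (sets (vimage_algebra (space M) (\<lambda>\<omega>. \<lambda>p\<in>{0..} \<times> UNIV. w (fst p) (snd p) \<omega>)
             (\<Pi>\<^sub>M p\<in>{0..} \<times> UNIV. borel)))
     \<and> (AE \<omega> in M.
          (\<forall>t\<ge>0. \<eta> t \<omega> \<in> weighted_fields r)
          \<and> (\<forall>t\<ge>0. ((\<lambda>s. weighted_dist r (\<eta> s \<omega>) (\<eta> t \<omega>)) \<longlongrightarrow> 0) (at t within {0..}))
          \<and> (\<forall>t\<ge>0. \<forall>b\<in>bonds. \<eta> t \<omega> b = \<eta> 0 \<omega> b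
               - integral {0..t} (\<lambda>s. grad (site_force V (\<eta> s \<omega>)) b)
               + sqrt 2 * grad (\<lambda>x. w t x \<omega>) b))"

(* Strong uniqueness gives uniqueness in law, so whether the solution started from \<mu> keeps the law
   \<mu> does not depend on the realization (nor on r), and it suffices to ask for one. The sample
   space is taken in the type of pairs of paths: a solution on any probability space can be
   transported there by \<omega> \<mapsto> (noise path, solution path). *)
definition stationary_measure :: "(real \<Rightarrow> real) \<Rightarrow> 'd::finite bond_field measure \<Rightarrow> bool" where
  "stationary_measure V \<mu> \<longleftrightarrow>
     (\<exists>r>0. \<exists>(M :: ((real \<Rightarrow> 'd site \<Rightarrow> real) \<times> (real \<Rightarrow> 'd bond_field)) measure) w \<eta>.
        gradient_sde_solution V r M w \<eta> \<and> (\<forall>t\<ge>0. distr M gradient_space (\<eta> t) = \<mu>))"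

definition tempered :: "'d::finite bond_field measure \<Rightarrow> bool" where
  "tempered \<mu> \<longleftrightarrow> (\<forall>b\<in>bonds. integrable \<mu> (\<lambda>\<eta>. \<bar>\<eta> b\<bar>\<^sup>2))"

definition shift :: "'d::finite site \<Rightarrow> 'd bond_field \<Rightarrow> 'd bond_field" where
  "shift z \<eta> = (\<lambda>b\<in>bonds. \<eta> (fst b + z, snd b + z))"

definition translation_invariant :: "'d::finite bond_field measure \<Rightarrow> bool" where
  "translation_invariant \<mu> \<longleftrightarrow> (\<forall>z. distr \<mu> gradient_space (shift z) = \<mu>)"

definition shift_ergodic :: "'d::finite bond_field measure \<Rightarrow> bool" where
  "shift_ergodic \<mu> \<longleftrightarrow> (\<forall>A\<in>sets \<mu>. (\<forall>z. shift z -` A \<inter> space \<mu> = A) \<longrightarrow>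
     measure \<mu> A = 0 \<or> measure \<mu> A = 1)"

definition S_ext :: "(real \<Rightarrow> real) \<Rightarrow> 'd::finite bond_field measure set" where
  "S_ext V = {\<mu>. prob_space \<mu> \<and> sets \<mu> = sets gradient_space
     \<and> stationary_measure V \<mu> \<and> tempered \<mu> \<and> translation_invariant \<mu> \<and> shift_ergodic \<mu>}"

end

theory Submission
  imports Defs
begin

text \<open>
  The idea is to test stationarity on one quadratic observable.
  Let \<open>p\<close> be a finitely supported probability weight on the lattice and let \<open>q\<close> be the point mass
  at 0 minus \<open>p\<close>. Since \<open>q\<close> has total mass 0, \<open>X = (\<Sum>y. q y * \<phi> y)\<close> is a finite linear combination of
  bond variables of \<open>\<eta> = \<nabla>\<phi>\<close>, and along the dynamics it has drift \<open>- Q\<close> with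
  \<open>Q = (\<Sum>y. q y * U\<^sub>y(\<eta>))\<close>. Under a stationary law the second moment of \<open>X\<close> does not change, so in short
  time the dissipation balances the noise: \<open>E[X Q]\<close> is at most \<open>2 (\<Sum>y. \<bar>q y\<bar>)\<^sup>2 \<le> 8\<close>, whatever
  \<open>p\<close> is (lemma \<open>stationary_dissipation_le\<close>). No growth of the heights is involved.

  Translation invariance and the oddness of \<open>V'\<close> allow a summation by parts
  (lemma \<open>dissipation_eq\<close>): \<open>E[X Q]\<close> is half the sum over the unit vectors \<open>e\<close> of
  \<open>E[(q * V'(\<eta>\<^sub>e)) (q * \<eta>\<^sub>e)]\<close>, where \<open>\<eta>\<^sub>e\<close> is the field of bond variables in direction \<open>e\<close> and \<open>q *\<close>
  denotes the sum of the translates of a field with weights \<open>q\<close>. Here \<open>q *\<close> may be applied to the centred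
  fields, for which it is the identity minus the average \<open>p *\<close>. By ergodicity,
  \<open>p\<close> can be chosen such that these averages of the finitely many centred fields \<open>\<eta>\<^sub>e - E \<eta>\<^sub>e\<close> and
  \<open>V'(\<eta>\<^sub>e) - E V'(\<eta>\<^sub>e)\<close> are arbitrarily small in mean square (lemma
  \<open>mean_ergodic_averages\<close>). In the limit, with \<open>u\<^sub>e = E \<eta>\<^sub>e\<close>, the sum over \<open>e\<close> of
  \<open>E[(V'(\<eta>\<^sub>e) - V'(u\<^sub>e)) (\<eta>\<^sub>e - u\<^sub>e)]\<close> is at most 16 (lemma \<open>local_dissipation_le\<close>). Finally \<open>V'\<close> is the
  sum of a strongly monotone function and a bounded one, so the expectation in direction \<open>e\<close> is at
  least a multiple of the variance of \<open>\<eta>\<^sub>e\<close> minus a constant, and neither depends on the tilt \<open>u\<close>.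
\<close>

section \<open>The derivative of the potential\<close>

text \<open>The perturbation \<open>g\<close> has bounded derivative, so \<open>V'\<close> inherits the strong monotonicity of the
  derivative of \<open>V\<^sub>0\<close> up to a term linear in the distance.\<close>

lemma potential_derivative:
  assumes "assumption_A V"
  obtains c C L where "c > 0" "C > 0" "L > 0"
    "\<And>u. deriv V (- u) = - deriv V u"
    "\<And>a b. \<bar>deriv V a - deriv V b\<bar> \<le> L * \<bar>a - b\<bar>"
    "\<And>a b. (deriv V a - deriv V b) * (a - b) \<ge> c * (a - b)\<^sup>2 - 2 * C * \<bar>a - b\<bar>"
proof -
  obtain V0 g c cp C where V: "V = (\<lambda>u. V0 u + g u)" and C2: "C2 V0" "C2 g"
    and even: "\<And>u. V0 (- u) = V0 u" "\<And>u. g (- u) = g u"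
    and pos: "c > 0" "cp > 0" "C > 0"
    and hess: "\<And>u. c \<le> deriv (deriv V0) u" "\<And>u. deriv (deriv V0) u \<le> cp"
    and pert: "\<And>u. \<bar>deriv g u\<bar> + \<bar>deriv (deriv g) u\<bar> \<le> C"
    using assms unfolding assumption_A_def by blast
  have D: "(V0 has_real_derivative deriv V0 u) (at u)" "(g has_real_derivative deriv g u) (at u)"
    "(deriv V0 has_real_derivative deriv (deriv V0) u) (at u)"
    "(deriv g has_real_derivative deriv (deriv g) u) (at u)" for u
    using C2 unfolding C2_def by (auto simp: DERIV_deriv_iff_field_differentiable)
  have dV: "deriv V u = deriv V0 u + deriv g u" for u
    unfolding V by (intro DERIV_imp_deriv DERIV_add D)
  have odd: "deriv f (- u) = - deriv f u"
    if "\<And>u. f (- u) = f u" "\<And>u. (f has_real_derivative deriv f u) (at u)" for f and u :: real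
  proof -
    have "((\<lambda>x. f (- x)) has_real_derivative deriv f (- u) * (- 1)) (at u)"
      by (rule DERIV_chain2[where f = f]) (auto intro!: that(2) derivative_eq_intros)
    then have "(f has_real_derivative deriv f (- u) * (- 1)) (at u)" using that(1) by simp
    with that(2)[of u] show ?thesis using DERIV_unique by fastforce
  qed
  have odd_V: "deriv V (- u) = - deriv V u" for u
    using odd[of V0 u] odd[of g u] even D by (simp add: dV)
  have mvt: "\<exists>z. f a - f b = (a - b) * f' z"
    if "\<And>u. (f has_real_derivative f' u) (at u)" for f f' :: "real \<Rightarrow> real" and a b
  proof (cases a b rule: linorder_cases)
    case less
    with MVT2[of a b f f'] that obtain z where "f b - f a = (b - a) * f' z" by auto
    then have "f a - f b = (a - b) * f' z" by (simp add: algebra_simps)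
    then show ?thesis by blast
  next
    case greater
    with MVT2[of b a f f'] that show ?thesis by auto
  qed simp
  have pert': "\<bar>deriv g u\<bar> \<le> C" "\<bar>deriv (deriv g) u\<bar> \<le> C" for u
    by (rule order_trans[OF _ pert[of u]], simp)+
  have lip: "\<bar>deriv V a - deriv V b\<bar> \<le> (cp + C) * \<bar>a - b\<bar>" for a b
  proof -
    have "\<exists>z. deriv V a - deriv V b = (a - b) * (deriv (deriv V0) z + deriv (deriv g) z)"
      by (rule mvt) (auto simp: dV[abs_def] intro!: DERIV_add D)
    then obtain z where z: "deriv V a - deriv V b = (a - b) * (deriv (deriv V0) z + deriv (deriv g) z)" ..
    have "\<bar>deriv (deriv V0) z + deriv (deriv g) z\<bar> \<le> cp + C"
      using abs_triangle_ineq[of "deriv (deriv V0) z" "deriv (deriv g) z"] hess[of z] pert'(2)[of z] pos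
      by simp
    then show ?thesis unfolding z abs_mult mult.commute[of "\<bar>a - b\<bar>"]
      by (rule mult_right_mono) simp
  qed
  have mono: "(deriv V a - deriv V b) * (a - b) \<ge> c * (a - b)\<^sup>2 - 2 * C * \<bar>a - b\<bar>" for a b
  proof -
    obtain z where z: "deriv V0 a - deriv V0 b = (a - b) * deriv (deriv V0) z"
      using mvt[of "deriv V0" "deriv (deriv V0)"] D by blast
    have "(deriv V0 a - deriv V0 b) * (a - b) = deriv (deriv V0) z * (a - b)\<^sup>2"
      by (simp add: z power2_eq_square)
    also have "\<dots> \<ge> c * (a - b)\<^sup>2" by (intro mult_right_mono hess) auto
    finally have 1: "(deriv V0 a - deriv V0 b) * (a - b) \<ge> c * (a - b)\<^sup>2" .
    have "\<bar>deriv g a - deriv g b\<bar> \<le> 2 * C"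
      by (rule order_trans[OF abs_triangle_ineq4]) (use pert'(1)[of a] pert'(1)[of b] in simp)
    then have "\<bar>(deriv g a - deriv g b) * (a - b)\<bar> \<le> 2 * C * \<bar>a - b\<bar>"
      unfolding abs_mult by (intro mult_right_mono) auto
    with 1 show ?thesis by (simp add: dV algebra_simps)
  qed
  show ?thesis using that[of c C "cp + C"] pos odd_V lip mono by auto
qed

section \<open>The lattice and linear functionals of gradients\<close>

text \<open>The unit vectors of the lattice, that is, the sites adjacent to the origin.\<close>

definition neighbours :: "'d::finite site set" where
  "neighbours = {e. site_norm e = 1}"

lemma site_norm_uminus [simp]: "site_norm (- x) = site_norm x"
proof -
  have "(\<chi> i. real_of_int ((- x) $ i)) = - (\<chi> i. real_of_int (x $ i))"
    by (simp add: vec_eq_iff)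
  then show ?thesis by (simp add: site_norm_def)
qed

lemma mem_bonds_iff: "(x, y) \<in> bonds \<longleftrightarrow> y - x \<in> neighbours"
  using site_norm_uminus[of "x - y"] by (simp add: bonds_def neighbours_def)

lemma uminus_neighbours: "e \<in> neighbours \<longleftrightarrow> - e \<in> neighbours"
  by (simp add: neighbours_def)

lemma bonds_translate [simp]: "(x + z, y + z) \<in> bonds \<longleftrightarrow> (x, y) \<in> bonds"
  by (simp add: mem_bonds_iff)

lemma finite_neighbours: "finite (neighbours :: 'd::finite site set)"
proof -
  have "(neighbours :: 'd site set) \<subseteq> (\<lambda>f. \<chi> i. f i) ` (UNIV \<rightarrow>\<^sub>E {-1..1::int})"
  proof
    fix e :: "'d site" assume "e \<in> neighbours"
    then have n: "norm (\<chi> i. real_of_int (e $ i)) = 1" by (simp add: neighbours_def site_norm_def)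
    have "\<bar>e $ i\<bar> \<le> 1" for i
      using component_le_norm_cart[of "\<chi> i. real_of_int (e $ i)" i] n by simp
    then have "(\<lambda>i. e $ i) \<in> UNIV \<rightarrow>\<^sub>E {-1..1}" by (auto simp: abs_le_iff)
    moreover have "e = (\<chi> i. (\<lambda>i. e $ i) i)" by simp
    ultimately show "e \<in> (\<lambda>f. \<chi> i. f i) ` (UNIV \<rightarrow>\<^sub>E {-1..1::int})" by blast
  qed
  then show ?thesis by (rule finite_subset) (intro finite_imageI finite_PiE, auto)
qed

lemma axis_neighbour: "axis i 1 \<in> (neighbours :: 'd::finite site set)"
proof -
  have "(\<chi> j. real_of_int (axis i 1 $ j)) = (axis i 1 :: real ^ 'd)"
    by (simp add: vec_eq_iff axis_def)
  then show ?thesis by (simp add: neighbours_def site_norm_def)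
qed

lemma site_force_eq_sum_neighbours:
  "site_force V \<eta> x = (\<Sum>e\<in>neighbours. deriv V (\<eta> (x, x + e)))"
proof -
  have "{b \<in> bonds. fst b = x} = (\<lambda>e. (x, x + e)) ` neighbours"
    by (auto simp: mem_bonds_iff image_iff intro!: bexI[of _ "_ - x"])
  then show ?thesis unfolding site_force_def by (simp add: sum.reindex inj_on_def)
qed

text \<open>The functionals of the height field which are finite linear combinations of its gradients.\<close>

definition gradient_functional :: "(('d::finite site \<Rightarrow> real) \<Rightarrow> real) \<Rightarrow> bool" where
  "gradient_functional l \<longleftrightarrow>
     (\<exists>B c. finite B \<and> B \<subseteq> bonds \<and> (\<forall>\<phi>. l \<phi> = (\<Sum>b\<in>B. c b * grad \<phi> b)))"

lemma gradient_functional_bond: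
  assumes "(x, y) \<in> bonds"
  shows "gradient_functional (\<lambda>\<phi>. \<phi> x - \<phi> y)"
  unfolding gradient_functional_def
  by (rule exI[of _ "{(x, y)}"], rule exI[of _ "\<lambda>_. 1"]) (use assms in \<open>simp add: grad_def\<close>)

lemma gradient_functional_zero: "gradient_functional (\<lambda>_. 0)"
  unfolding gradient_functional_def by (rule exI[of _ "{}"]) simp

lemma gradient_functional_scale:
  assumes "gradient_functional l"
  shows "gradient_functional (\<lambda>\<phi>. a * l \<phi>)"
proof -
  obtain B c where B: "finite B" "B \<subseteq> bonds" "\<And>\<phi>. l \<phi> = (\<Sum>b\<in>B. c b * grad \<phi> b)"
    using assms unfolding gradient_functional_def by blast
  then have "a * l \<phi> = (\<Sum>b\<in>B. (a * c b) * grad \<phi> b)" for \<phi>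
    by (simp add: sum_distrib_left mult.assoc)
  with B show ?thesis unfolding gradient_functional_def
    by (intro exI[of _ B] exI[of _ "\<lambda>b. a * c b"]) simp
qed

lemma gradient_functional_add:
  assumes "gradient_functional l" "gradient_functional l'"
  shows "gradient_functional (\<lambda>\<phi>. l \<phi> + l' \<phi>)"
proof -
  obtain B c where B: "finite B" "B \<subseteq> bonds" "\<And>\<phi>. l \<phi> = (\<Sum>b\<in>B. c b * grad \<phi> b)"
    using assms unfolding gradient_functional_def by blast
  obtain B' c' where B': "finite B'" "B' \<subseteq> bonds" "\<And>\<phi>. l' \<phi> = (\<Sum>b\<in>B'. c' b * grad \<phi> b)"
    using assms unfolding gradient_functional_def by blast
  define d where "d b = (if b \<in> B then c b else 0) + (if b \<in> B' then c' b else 0)" for b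
  have "l \<phi> + l' \<phi> = (\<Sum>b\<in>B \<union> B'. d b * grad \<phi> b)" for \<phi>
  proof -
    have "(\<Sum>b\<in>B. c b * grad \<phi> b) = (\<Sum>b\<in>B \<union> B'. (if b \<in> B then c b else 0) * grad \<phi> b)"
      using B B' by (intro sum.mono_neutral_cong_left) auto
    moreover have "(\<Sum>b\<in>B'. c' b * grad \<phi> b) = (\<Sum>b\<in>B \<union> B'. (if b \<in> B' then c' b else 0) * grad \<phi> b)"
      using B B' by (intro sum.mono_neutral_cong_left) auto
    ultimately show ?thesis
      unfolding B(3) B'(3) d_def by (simp add: sum.distrib distrib_right)
  qed
  with B B' show ?thesis unfolding gradient_functional_def
    by (intro exI[of _ "B \<union> B'"] exI[of _ d]) simp
qed

lemma gradient_functional_sum: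
  assumes "finite S" "\<And>y. y \<in> S \<Longrightarrow> gradient_functional (l y)"
  shows "gradient_functional (\<lambda>\<phi>. \<Sum>y\<in>S. l y \<phi>)"
  using assms by (induction S rule: finite_induct) (auto intro: gradient_functional_zero gradient_functional_add)

text \<open>Any two sites are joined by a lattice path, found by changing one coordinate after the other
  in unit steps.\<close>

lemma gradient_functional_difference:
  fixes x y :: "'d::finite site"
  shows "gradient_functional (\<lambda>\<phi>. \<phi> y - \<phi> x)"
proof -
  let ?G = "\<lambda>y x :: 'd site. gradient_functional (\<lambda>\<phi>. \<phi> y - \<phi> x)"
  have trans: "?G y z" if "?G y x" "?G x z" for x y z
    using gradient_functional_add[OF that] by simp
  have neg: "?G x y" if "?G y x" for x y
    using gradient_functional_scale[OF that, of "-1"] by simp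
  have step: "?G (x + axis i 1) x" for x and i
    using axis_neighbour[of i] by (intro gradient_functional_bond) (simp add: mem_bonds_iff flip: uminus_neighbours)
  have refl: "?G x x" for x using gradient_functional_zero by simp
  have axis_add: "axis i a + axis i b = axis i (a + b)" for i and a b :: int
    by (simp add: vec_eq_iff axis_def)
  have line: "?G (x + axis i k) x" for x and i and k :: int
  proof (induction k rule: int_induct[of _ 0])
    case base
    have axis_0: "axis i (0 :: int) = 0" by (simp add: vec_eq_iff axis_def)
    show ?case unfolding axis_0 using refl[of x] by simp
  next
    case (step1 k)
    have eq: "x + axis i (k + 1) = (x + axis i k) + axis i 1" by (simp add: add.assoc axis_add)
    show ?case unfolding eq by (rule trans[OF step step1(2)])
  next
    case (step2 k)
    have eq: "x + axis i k = (x + axis i (k - 1)) + axis i 1" by (simp add: add.assoc axis_add)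
    show ?case by (rule trans[OF neg[OF step] step2(2)[unfolded eq]])
  qed
  have "?G (x + (\<Sum>i\<in>I. axis i (z $ i))) x" if "finite I" for I and z :: "'d site"
    using that
  proof (induction I rule: finite_induct)
    case empty
    then show ?case using refl by simp
  next
    case (insert i I)
    have eq: "x + (\<Sum>i\<in>insert i I. axis i (z $ i)) = (x + (\<Sum>i\<in>I. axis i (z $ i))) + axis i (z $ i)"
      using insert by simp
    show ?case unfolding eq by (rule trans[OF line insert.IH])
  qed
  from this[of UNIV "y - x"] have "?G (x + (\<Sum>i\<in>UNIV. axis i ((y - x) $ i))) x" by simp
  moreover have "(\<Sum>i\<in>UNIV. axis i ((y - x) $ i)) = y - x"
    by (simp add: vec_eq_iff axis_def sum.delta)
  ultimately show ?thesis by simp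
qed

text \<open>The heights enter the argument only through weights of total mass 0, which do not see the constant
  left free by the gradients.\<close>

lemma gradient_functional_weighted:
  assumes "finite S" "(\<Sum>y\<in>S. q y) = 0"
  shows "gradient_functional (\<lambda>\<phi>. \<Sum>y\<in>S. q y * \<phi> y)"
proof -
  have "(\<Sum>y\<in>S. q y * \<phi> y) = (\<Sum>y\<in>S. q y * (\<phi> y - \<phi> 0))" for \<phi>
    using assms(2) by (simp add: right_diff_distrib sum_subtractf flip: sum_distrib_right)
  moreover have "gradient_functional (\<lambda>\<phi>. \<Sum>y\<in>S. q y * (\<phi> y - \<phi> 0))"
    by (intro gradient_functional_sum assms gradient_functional_scale gradient_functional_difference)
  ultimately show ?thesis by simp
qed

section \<open>The space of gradient fields\<close>

lemma space_gradient_space: "space (gradient_space :: 'd::finite bond_field measure) = gradient_fields"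
proof -
  have "(gradient_fields :: 'd bond_field set) \<subseteq> space (\<Pi>\<^sub>M b\<in>bonds. (borel :: real measure))"
    by (auto simp: gradient_fields_def grad_def space_PiM PiE_def)
  then show ?thesis by (simp add: gradient_space_def space_restrict_space Int_absorb2)
qed

lemma measurable_bond [measurable (raw)]:
  assumes "b \<in> bonds"
  shows "(\<lambda>\<eta>. \<eta> b) \<in> borel_measurable gradient_space"
  unfolding gradient_space_def
  by (intro measurable_restrict_space1 measurable_component_singleton assms)

lemma bond_shift: "b \<in> bonds \<Longrightarrow> (fst b + z, snd b + z) \<in> bonds"
  by (cases b) simp

lemma shift_grad: "shift z (grad \<phi>) = grad (\<lambda>x. \<phi> (x + z))"
  by (rule ext) (simp add: shift_def grad_def restrict_def bond_shift)

lemma shift_shift: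
  assumes "\<eta> \<in> gradient_fields"
  shows "shift z (shift y \<eta>) = shift (z + y) \<eta>"
  using assms by (auto simp: gradient_fields_def shift_grad add.assoc)

lemma shift_bond: "(x, y) \<in> bonds \<Longrightarrow> shift z \<eta> (x, y) = \<eta> (x + z, y + z)"
  by (simp add: shift_def)

lemma measurable_shift [measurable]: "shift z \<in> gradient_space \<rightarrow>\<^sub>M gradient_space"
proof -
  have "shift z \<eta> \<in> gradient_fields" if "\<eta> \<in> gradient_fields" for \<eta>
    using that by (auto simp: gradient_fields_def shift_grad)
  moreover have "shift z \<in> gradient_space \<rightarrow>\<^sub>M (\<Pi>\<^sub>M b\<in>bonds. borel)"
    unfolding shift_def by (intro measurable_restrict measurable_bond bond_shift)
  ultimately show ?thesis
    using measurable_restrict_space2[of "shift z" gradient_space gradient_fields "\<Pi>\<^sub>M b\<in>bonds. borel"]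
    by (simp add: gradient_space_def[symmetric] space_gradient_space)
qed

lemma gradient_fields_antisym:
  assumes "\<eta> \<in> gradient_fields" "(x, y) \<in> bonds"
  shows "\<eta> (x, y) = - \<eta> (y, x)"
proof -
  have "(y, x) \<in> bonds" using assms(2) uminus_neighbours[of "y - x"] by (simp add: mem_bonds_iff)
  then show ?thesis using assms by (auto simp: gradient_fields_def grad_def)
qed

section \<open>Square integrable functions\<close>

lemma integrable_mult_of_squares:
  fixes f g :: "'a \<Rightarrow> real"
  assumes [measurable]: "f \<in> borel_measurable M" "g \<in> borel_measurable M"
    and "integrable M (\<lambda>x. (f x)\<^sup>2)" "integrable M (\<lambda>x. (g x)\<^sup>2)"
  shows "integrable M (\<lambda>x. f x * g x)"
proof (rule Bochner_Integration.integrable_bound)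
  show "integrable M (\<lambda>x. (f x)\<^sup>2 + (g x)\<^sup>2)" using assms by simp
  have "\<bar>a * b\<bar> \<le> a\<^sup>2 + b\<^sup>2" for a b :: real
  proof -
    have "2 * \<bar>a * b\<bar> \<le> a\<^sup>2 + b\<^sup>2"
      using sum_squares_bound[of "\<bar>a\<bar>" "\<bar>b\<bar>"] by (simp add: abs_mult mult.assoc)
    then show ?thesis by linarith
  qed
  then show "AE x in M. norm (f x * g x) \<le> norm ((f x)\<^sup>2 + (g x)\<^sup>2)" by simp
qed simp

lemma integrable_square_add:
  fixes f g :: "'a \<Rightarrow> real"
  assumes [measurable]: "f \<in> borel_measurable M" "g \<in> borel_measurable M"
    and "integrable M (\<lambda>x. (f x)\<^sup>2)" "integrable M (\<lambda>x. (g x)\<^sup>2)"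
  shows "integrable M (\<lambda>x. (f x + g x)\<^sup>2)"
  unfolding power2_sum using integrable_mult_of_squares[OF assms] assms
  by (auto intro!: Bochner_Integration.integrable_add simp: mult.assoc)

lemma integrable_square_cmult:
  fixes f :: "'a \<Rightarrow> real"
  assumes "integrable M (\<lambda>x. (f x)\<^sup>2)"
  shows "integrable M (\<lambda>x. (a * f x)\<^sup>2)"
  unfolding power_mult_distrib using assms by simp

lemma integrable_square_diff:
  fixes f g :: "'a \<Rightarrow> real"
  assumes "f \<in> borel_measurable M" "g \<in> borel_measurable M"
    and "integrable M (\<lambda>x. (f x)\<^sup>2)" "integrable M (\<lambda>x. (g x)\<^sup>2)"
  shows "integrable M (\<lambda>x. (f x - g x)\<^sup>2)"
  using integrable_square_add[of f M "\<lambda>x. - g x"] assms by simp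

lemma integrable_square_sum:
  fixes f :: "'i \<Rightarrow> 'a \<Rightarrow> real"
  assumes "finite I" "\<And>i. i \<in> I \<Longrightarrow> f i \<in> borel_measurable M"
    and "\<And>i. i \<in> I \<Longrightarrow> integrable M (\<lambda>x. (f i x)\<^sup>2)"
  shows "integrable M (\<lambda>x. (\<Sum>i\<in>I. f i x)\<^sup>2)"
  using assms
proof (induction I rule: finite_induct)
  case (insert i I)
  have "(\<lambda>x. \<Sum>j\<in>I. f j x) \<in> borel_measurable M" using insert by (intro borel_measurable_sum) auto
  then have "integrable M (\<lambda>x. (f i x + (\<Sum>j\<in>I. f j x))\<^sup>2)"
    using insert by (intro integrable_square_add) auto
  then show ?case using insert by simp
qed simp

text \<open>A form of Young's inequality; it stands in for the Cauchy--Schwarz inequality below.\<close>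

lemma integral_mult_le_weighted_squares:
  fixes f g :: "'a \<Rightarrow> real"
  assumes "f \<in> borel_measurable M" "g \<in> borel_measurable M"
    and "integrable M (\<lambda>x. (f x)\<^sup>2)" "integrable M (\<lambda>x. (g x)\<^sup>2)" and "a > 0"
  shows "\<bar>\<integral>x. f x * g x \<partial>M\<bar> \<le> a / 2 * (\<integral>x. (f x)\<^sup>2 \<partial>M) + (\<integral>x. (g x)\<^sup>2 \<partial>M) / (2 * a)"
proof -
  have pw: "\<bar>s * t\<bar> \<le> a / 2 * s\<^sup>2 + t\<^sup>2 / (2 * a)" for s t :: real
  proof -
    have "0 \<le> (a * \<bar>s\<bar> - \<bar>t\<bar>)\<^sup>2" by simp
    then have "2 * (a * \<bar>s * t\<bar>) \<le> a\<^sup>2 * s\<^sup>2 + t\<^sup>2" by (simp add: power2_diff power_mult_distrib abs_mult)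
    then show ?thesis using \<open>a > 0\<close> by (simp add: field_simps power2_eq_square)
  qed
  have "\<bar>\<integral>x. f x * g x \<partial>M\<bar> \<le> (\<integral>x. \<bar>f x * g x\<bar> \<partial>M)" by (rule integral_abs_bound)
  also have "\<dots> \<le> (\<integral>x. a / 2 * (f x)\<^sup>2 + (g x)\<^sup>2 / (2 * a) \<partial>M)"
    using integrable_mult_of_squares[OF assms(1-4)] assms pw by (intro integral_mono) auto
  also have "\<dots> = a / 2 * (\<integral>x. (f x)\<^sup>2 \<partial>M) + (\<integral>x. (g x)\<^sup>2 \<partial>M) / (2 * a)"
    using assms by simp
  finally show ?thesis .
qed

text \<open>Fatou's lemma for second moments.\<close>

lemma square_integral_limit_le:
  fixes f :: "nat \<Rightarrow> 'a \<Rightarrow> real"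
  assumes [measurable]: "\<And>n. f n \<in> borel_measurable M" "g \<in> borel_measurable M"
    and lim: "AE x in M. (\<lambda>n. f n x) \<longlonglongrightarrow> g x"
    and int: "\<And>n. integrable M (\<lambda>x. (f n x)\<^sup>2)"
    and bound: "eventually (\<lambda>n. (\<integral>x. (f n x)\<^sup>2 \<partial>M) \<le> K) sequentially"
  shows "integrable M (\<lambda>x. (g x)\<^sup>2)" "(\<integral>x. (g x)\<^sup>2 \<partial>M) \<le> K"
proof -
  have K: "K \<ge> 0"
  proof -
    obtain n where "(\<integral>x. (f n x)\<^sup>2 \<partial>M) \<le> K" using bound by (auto simp: eventually_sequentially)
    moreover have "(\<integral>x. (f n x)\<^sup>2 \<partial>M) \<ge> 0" by simp
    ultimately show ?thesis by linarith
  qed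
  have "(\<integral>\<^sup>+x. ennreal ((g x)\<^sup>2) \<partial>M) = (\<integral>\<^sup>+x. liminf (\<lambda>n. ennreal ((f n x)\<^sup>2)) \<partial>M)"
  proof (rule nn_integral_cong_AE)
    show "AE x in M. ennreal ((g x)\<^sup>2) = liminf (\<lambda>n. ennreal ((f n x)\<^sup>2))"
      using lim
    proof eventually_elim
      case (elim x)
      then have "(\<lambda>n. ennreal ((f n x)\<^sup>2)) \<longlonglongrightarrow> ennreal ((g x)\<^sup>2)"
        by (intro tendsto_ennrealI tendsto_power)
      then show ?case by (rule lim_imp_Liminf[OF sequentially_bot, symmetric])
    qed
  qed
  also have "\<dots> \<le> liminf (\<lambda>n. \<integral>\<^sup>+x. ennreal ((f n x)\<^sup>2) \<partial>M)"
    by (rule nn_integral_liminf) simp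
  also have "\<dots> \<le> limsup (\<lambda>n. \<integral>\<^sup>+x. ennreal ((f n x)\<^sup>2) \<partial>M)"
    by (rule Liminf_le_Limsup) simp
  also have "\<dots> \<le> ennreal K"
    using bound
    by (intro Limsup_bounded) (auto elim!: eventually_mono simp: nn_integral_eq_integral[OF int] ennreal_leI)
  finally have le: "(\<integral>\<^sup>+x. ennreal ((g x)\<^sup>2) \<partial>M) \<le> ennreal K" .
  then have "(\<integral>\<^sup>+x. ennreal ((g x)\<^sup>2) \<partial>M) < \<infinity>" by (rule le_less_trans) simp
  then show int_g: "integrable M (\<lambda>x. (g x)\<^sup>2)" by (intro integrableI_nonneg) auto
  show "(\<integral>x. (g x)\<^sup>2 \<partial>M) \<le> K"
    using le K by (simp add: nn_integral_eq_integral[OF int_g])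
qed

lemma (in prob_space) square_expectation_le:
  assumes "f \<in> borel_measurable M" "integrable M (\<lambda>x. (f x)\<^sup>2)"
  shows "expectation (\<lambda>x. \<bar>f x\<bar>) \<le> sqrt (expectation (\<lambda>x. (f x)\<^sup>2))"
proof -
  have i: "integrable M (\<lambda>x. \<bar>f x\<bar>)" using square_integrable_imp_integrable[OF assms] by simp
  have "(expectation (\<lambda>x. \<bar>f x\<bar>))\<^sup>2 \<le> expectation (\<lambda>x. \<bar>f x\<bar>\<^sup>2)"
    using variance_positive[of "\<lambda>x. \<bar>f x\<bar>"] variance_eq[OF i] assms by simp
  then show ?thesis by (intro real_le_rsqrt) simp
qed

section \<open>A mean ergodic theorem\<close>

text \<open>Ergodicity speaks of strictly invariant sets, the function is invariant only almost surely. As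
  the group is countable, a level set of \<open>F\<close> differs by a null set from the strictly invariant set of
  all \<open>x\<close> such that \<open>F (T z x) \<le> a\<close> for every \<open>z\<close>. The constant is then the infimum of the almost sure
  upper bounds.\<close>

lemma AE_constant_if_invariant:
  fixes T :: "'g::{countable, group_add} \<Rightarrow> 'a \<Rightarrow> 'a" and F :: "'a \<Rightarrow> real"
  assumes "prob_space M"
    and T: "\<And>z. T z \<in> M \<rightarrow>\<^sub>M M"
    and action: "\<And>y z x. x \<in> space M \<Longrightarrow> T z (T y x) = T (z + y) x"
    and ergodic: "\<And>A. A \<in> sets M \<Longrightarrow> (\<And>z. T z -` A \<inter> space M = A) \<Longrightarrow> measure M A = 0 \<or> measure M A = 1"
    and F[measurable]: "F \<in> borel_measurable M"
    and inv: "\<And>z. AE x in M. F (T z x) = F x"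
  shows "\<exists>c. AE x in M. F x = c"
proof -
  interpret prob_space M by fact
  note [measurable] = T
  have inv_all: "AE x in M. \<forall>z. F (T z x) = F x" using inv by (simp add: AE_all_countable)
  have zero_one: "(AE x in M. F x \<le> a) \<or> (AE x in M. F x > a)" for a
  proof -
    define A where "A = {x \<in> space M. \<forall>z. F (T z x) \<le> a}"
    have A[measurable]: "A \<in> sets M" unfolding A_def by measurable
    have "T y -` A \<inter> space M = A" for y
    proof (intro set_eqI iffI)
      fix x assume x: "x \<in> T y -` A \<inter> space M"
      have "F (T z x) \<le> a" for z
      proof -
        have "F (T (z - y) (T y x)) \<le> a" using x by (simp add: A_def)
        moreover have "T (z - y) (T y x) = T z x" using x action[of x "z - y" y] by simp
        ultimately show ?thesis by simp
      qed
      then show "x \<in> A" using x by (simp add: A_def)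
    next
      fix x assume x: "x \<in> A"
      then have "T y x \<in> space M" using measurable_space[OF T] by (auto simp: A_def)
      then show "x \<in> T y -` A \<inter> space M" using x by (auto simp: A_def action)
    qed
    then have "prob A = 0 \<or> prob A = 1" using ergodic A by blast
    then have "(AE x in M. x \<notin> A) \<or> (AE x in M. x \<in> A)"
      using prob_eq_0[OF A] prob_eq_1[OF A] by auto
    moreover have "AE x in M. x \<in> A \<longleftrightarrow> F x \<le> a"
      using inv_all AE_space by eventually_elim (auto simp: A_def)
    ultimately show ?thesis
    proof (elim disjE)
      assume "AE x in M. x \<notin> A" "AE x in M. x \<in> A \<longleftrightarrow> F x \<le> a"
      then have "AE x in M. F x > a" by eventually_elim auto
      then show ?thesis ..
    next
      assume "AE x in M. x \<in> A" "AE x in M. x \<in> A \<longleftrightarrow> F x \<le> a"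
      then have "AE x in M. F x \<le> a" by eventually_elim auto
      then show ?thesis ..
    qed
  qed
  define U where "U = {a. AE x in M. F x \<le> a}"
  have False if none: "\<And>n::nat. AE x in M. F x > real n"
  proof -
    have "AE x in M. \<forall>n. F x > real n" using none by (simp add: AE_all_countable)
    then have "AE x in M. False"
      by eventually_elim (meson less_asym reals_Archimedean2)
    then show False by simp
  qed
  then obtain n where "real n \<in> U" unfolding U_def using zero_one by blast
  then have U_ne: "U \<noteq> {}" by blast
  have False if all: "\<And>n::nat. AE x in M. F x \<le> - real n"
  proof -
    have "AE x in M. \<forall>n. F x \<le> - real n" using all by (simp add: AE_all_countable)
    then have "AE x in M. False"
    proof eventually_elim
      case (elim x)
      obtain n :: nat where "- F x < real n" using reals_Archimedean2 by blast
      with elim[rule_format, of n] show False by simp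
    qed
    then show False by simp
  qed
  then obtain m where m: "\<not> (AE x in M. F x \<le> - real m)" by blast
  have up: "b \<in> U" if "a \<in> U" "a \<le> b" for a b
    using that unfolding U_def by (auto elim!: eventually_mono)
  have "- real m \<le> a" if "a \<in> U" for a
    using that m up[of a "- real m"] by (force simp: U_def)
  then have U_bdd: "bdd_below U" by (intro bdd_belowI)
  define c where "c = Inf U"
  have 1: "AE x in M. \<forall>k. F x \<le> c + 1 / real (Suc k)"
  proof (unfold AE_all_countable, intro allI)
    fix k
    have "Inf U < c + 1 / real (Suc k)" by (simp add: c_def)
    then obtain a where "a \<in> U" "a < c + 1 / real (Suc k)" using cInf_lessD[OF U_ne] by blast
    then show "AE x in M. F x \<le> c + 1 / real (Suc k)" using up[of a] by (simp add: U_def)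
  qed
  have 2: "AE x in M. \<forall>k. F x > c - 1 / real (Suc k)"
  proof (unfold AE_all_countable, intro allI)
    fix k
    have "c - 1 / real (Suc k) \<notin> U"
    proof
      assume "c - 1 / real (Suc k) \<in> U"
      then have "c \<le> c - 1 / real (Suc k)" unfolding c_def using U_bdd by (rule cInf_lower)
      then show False by simp
    qed
    then show "AE x in M. F x > c - 1 / real (Suc k)" using zero_one by (auto simp: U_def)
  qed
  have "AE x in M. F x = c"
    using 1 2
  proof eventually_elim
    case (elim x)
    have l: "(\<lambda>k. 1 / real (Suc k)) \<longlonglongrightarrow> 0" by (rule LIMSEQ_Suc[OF lim_1_over_n])
    have "F x \<le> c + 0"
      by (rule LIMSEQ_le_const[OF tendsto_add[OF tendsto_const l]]) (use elim in blast)
    moreover have "c - 0 \<le> F x"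
      by (rule LIMSEQ_le_const2[OF tendsto_diff[OF tendsto_const l]]) (use elim less_imp_le in blast)
    ultimately show ?case by simp
  qed
  then show ?thesis ..
qed


lemma (in prob_space) AE_summable_if_square_expectation_geometric:
  fixes f :: "nat \<Rightarrow> 'a \<Rightarrow> real"
  assumes [measurable]: "\<And>n. f n \<in> borel_measurable M"
    and int: "\<And>n. integrable M (\<lambda>x. (f n x)\<^sup>2)"
    and bound: "\<And>n. expectation (\<lambda>x. (f n x)\<^sup>2) \<le> K * (1 / 4) ^ n"
  shows "AE x in M. summable (\<lambda>n. \<bar>f n x\<bar>)"
proof -
  have K: "K \<ge> 0" using order_trans[OF _ bound[of 0]] by simp
  have E: "expectation (\<lambda>x. \<bar>f n x\<bar>) \<le> sqrt K * (1 / 2) ^ n" for n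
  proof -
    have "expectation (\<lambda>x. \<bar>f n x\<bar>) \<le> sqrt (K * (1 / 4) ^ n)"
      using square_expectation_le[of "f n"] int bound[of n] real_sqrt_le_mono order_trans by fastforce
    also have "\<dots> = sqrt K * (1 / 2) ^ n"
      by (simp add: real_sqrt_mult real_sqrt_power real_sqrt_divide)
    finally show ?thesis .
  qed
  have i: "integrable M (\<lambda>x. \<bar>f n x\<bar>)" for n using square_integrable_imp_integrable[of "f n"] int by simp
  have sm: "summable (\<lambda>n. sqrt K * (1 / 2 :: real) ^ n)" by (intro summable_mult summable_geometric) simp
  have "(\<integral>\<^sup>+x. (\<Sum>n. ennreal \<bar>f n x\<bar>) \<partial>M) = (\<Sum>n. \<integral>\<^sup>+x. ennreal \<bar>f n x\<bar> \<partial>M)"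
    by (rule nn_integral_suminf) simp
  also have "\<dots> \<le> (\<Sum>n. ennreal (sqrt K * (1 / 2) ^ n))"
    by (rule suminf_le) (auto simp: nn_integral_eq_integral[OF i] intro!: ennreal_leI E)
  also have "\<dots> = ennreal (\<Sum>n. sqrt K * (1 / 2) ^ n)"
    using sm K by (intro suminf_ennreal2) auto
  finally have "(\<integral>\<^sup>+x. (\<Sum>n. ennreal \<bar>f n x\<bar>) \<partial>M) \<noteq> \<infinity>"
    by (metis ennreal_less_top infinity_ennreal_def leD)
  then have "AE x in M. (\<Sum>n. ennreal \<bar>f n x\<bar>) \<noteq> \<infinity>"
    by (intro nn_integral_noteq_infinite) auto
  then show ?thesis
    by eventually_elim (auto intro!: summable_suminf_not_top)
qed

text \<open>Von Neumann's mean ergodic theorem, in the form that the closed convex hull of the orbit of a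
  centred square integrable function contains 0; the weights are common to finitely many functions.
  Elements of the hull with nearly minimal norm are close to each other by the parallelogram
  identity. So a minimizing sequence converges, and the limit is invariant, because a translate of a
  nearly minimal element is again nearly minimal. Hence the limit is constant. As the elements of the hull
  are centred, their distance to a constant is at least their norm, which is therefore small.\<close>

lemma mean_ergodic_averages:
  fixes T :: "'g::{countable, group_add} \<Rightarrow> 'a \<Rightarrow> 'a" and h :: "'j \<Rightarrow> 'a \<Rightarrow> real"
  assumes "prob_space M"
    and T: "\<And>z. T z \<in> M \<rightarrow>\<^sub>M M"
    and preserving: "\<And>z. distr M M (T z) = M"
    and action: "\<And>y z x. x \<in> space M \<Longrightarrow> T z (T y x) = T (z + y) x"
    and ergodic: "\<And>A. A \<in> sets M \<Longrightarrow> (\<And>z. T z -` A \<inter> space M = A) \<Longrightarrow> measure M A = 0 \<or> measure M A = 1"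
    and "finite J"
    and h: "\<And>j. j \<in> J \<Longrightarrow> h j \<in> borel_measurable M" "\<And>j. j \<in> J \<Longrightarrow> integrable M (\<lambda>x. (h j x)\<^sup>2)"
    and mean: "\<And>j. j \<in> J \<Longrightarrow> (\<integral>x. h j x \<partial>M) = 0"
    and "\<epsilon> > 0"
  obtains S p where "finite S" "\<And>z. p z \<ge> 0" "\<And>z. z \<notin> S \<Longrightarrow> p z = 0" "(\<Sum>z\<in>S. p z) = 1"
    "\<And>j. j \<in> J \<Longrightarrow> (\<integral>x. (\<Sum>z\<in>S. p z * h j (T z x))\<^sup>2 \<partial>M) \<le> \<epsilon>"
proof -
  interpret prob_space M by fact
  define W where "W = {(S, p :: 'g \<Rightarrow> real). finite S \<and> (\<forall>z. p z \<ge> 0) \<and> (\<forall>z. z \<notin> S \<longrightarrow> p z = 0) \<and> (\<Sum>z\<in>S. p z) = 1}"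
  \<comment> \<open>The convex hull of the orbit. Its elements are families of functions indexed by \<open>J\<close>, specified only on
    \<open>J\<close> and on the space.\<close>
  define C where "C = {u. \<exists>(S, p)\<in>W. \<forall>j\<in>J. \<forall>x\<in>space M. u j x = (\<Sum>z\<in>S. p z * h j (T z x))}"
  define N where "N u = (\<Sum>j\<in>J. \<integral>x. (u j x)\<^sup>2 \<partial>M)" for u :: "'j \<Rightarrow> 'a \<Rightarrow> real"
  have hT: "(\<lambda>x. h j (T z x)) \<in> borel_measurable M" if "j \<in> J" for j z
    using measurable_compose[OF T h(1)[OF that]] .
  have shift_integral: "(\<integral>x. f (T z x) \<partial>M) = (\<integral>x. f x \<partial>M)" if "f \<in> borel_measurable M" for f :: "'a \<Rightarrow> real" and z
    using integral_distr[OF T that, of z] preserving by simp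
  have shift_integrable: "integrable M (\<lambda>x. f (T z x))" if "integrable M f" for f :: "'a \<Rightarrow> real" and z
    using integrable_distr_eq[OF T, of f z] preserving that by (simp add: borel_measurable_integrable)
  have CI: "u \<in> C" if "finite S" "\<And>z. p z \<ge> 0" "\<And>z. z \<notin> S \<Longrightarrow> p z = 0" "(\<Sum>z\<in>S. p z) = 1"
    "\<And>j x. j \<in> J \<Longrightarrow> x \<in> space M \<Longrightarrow> u j x = (\<Sum>z\<in>S. p z * h j (T z x))" for u S p
    using that unfolding C_def W_def by (intro CollectI bexI[of _ "(S, p)"]) auto
  have CE: "\<exists>S p. finite S \<and> (\<forall>z. p z \<ge> 0) \<and> (\<forall>z. z \<notin> S \<longrightarrow> p z = 0) \<and> (\<Sum>z\<in>S. p z) = 1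
    \<and> (\<forall>j\<in>J. \<forall>x\<in>space M. u j x = (\<Sum>z\<in>S. p z * h j (T z x)))" if "u \<in> C" for u
    using that unfolding C_def W_def by auto
  have C_meas: "u j \<in> borel_measurable M" and C_int: "integrable M (\<lambda>x. (u j x)\<^sup>2)"
    and C_mean: "(\<integral>x. u j x \<partial>M) = 0" if uj: "u \<in> C" "j \<in> J" for u j
  proof -
    obtain S p where S: "finite S" and u: "\<And>x. x \<in> space M \<Longrightarrow> u j x = (\<Sum>z\<in>S. p z * h j (T z x))"
      using CE[OF uj(1)] uj(2) by blast
    have m: "(\<lambda>x. p z * h j (T z x)) \<in> borel_measurable M" for z using hT[OF uj(2), of z] by simp
    have int_h: "integrable M (h j)" using square_integrable_imp_integrable[OF h] uj by auto
    show "u j \<in> borel_measurable M"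
      using m by (subst measurable_cong[OF u]) (auto intro!: borel_measurable_sum)
    have "integrable M (\<lambda>x. (\<Sum>z\<in>S. p z * h j (T z x))\<^sup>2)"
      using S m shift_integrable[OF h(2)[OF uj(2)]] by (intro integrable_square_sum integrable_square_cmult)
    then show "integrable M (\<lambda>x. (u j x)\<^sup>2)"
      using u by (subst Bochner_Integration.integrable_cong[OF refl]) auto
    have "(\<integral>x. u j x \<partial>M) = (\<integral>x. (\<Sum>z\<in>S. p z * h j (T z x)) \<partial>M)"
      using u by (intro Bochner_Integration.integral_cong) auto
    also have "\<dots> = (\<Sum>z\<in>S. p z * (\<integral>x. h j (T z x) \<partial>M))"
      using shift_integrable[OF int_h] by simp
    also have "\<dots> = 0" using shift_integral[OF h(1)[OF uj(2)]] mean[OF uj(2)] by simp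
    finally show "(\<integral>x. u j x \<partial>M) = 0" .
  qed
  have C_mid: "(\<lambda>j x. (u j x + v j x) / 2) \<in> C" if uv: "u \<in> C" "v \<in> C" for u v
  proof -
    obtain S p where S: "finite S" "\<forall>z. p z \<ge> 0" "\<forall>z. z \<notin> S \<longrightarrow> p z = 0" "(\<Sum>z\<in>S. p z) = 1"
      and u: "\<And>j x. j \<in> J \<Longrightarrow> x \<in> space M \<Longrightarrow> u j x = (\<Sum>z\<in>S. p z * h j (T z x))"
      using CE[OF uv(1)] by blast
    obtain R r where R: "finite R" "\<forall>z. r z \<ge> 0" "\<forall>z. z \<notin> R \<longrightarrow> r z = 0" "(\<Sum>z\<in>R. r z) = 1"
      and v: "\<And>j x. j \<in> J \<Longrightarrow> x \<in> space M \<Longrightarrow> v j x = (\<Sum>z\<in>R. r z * h j (T z x))"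
      using CE[OF uv(2)] by blast
    have ext: "(\<Sum>z\<in>S. p z * f z) = (\<Sum>z\<in>S \<union> R. p z * f z)" "(\<Sum>z\<in>R. r z * f z) = (\<Sum>z\<in>S \<union> R. r z * f z)" for f
      using S R by (auto intro!: sum.mono_neutral_left)
    show ?thesis
    proof (rule CI[of "S \<union> R" "\<lambda>z. (p z + r z) / 2"])
      show "(\<Sum>z\<in>S \<union> R. (p z + r z) / 2) = 1"
        using ext[of "\<lambda>_. 1"] S R by (simp add: sum.distrib flip: sum_divide_distrib)
      show "(u j x + v j x) / 2 = (\<Sum>z\<in>S \<union> R. (p z + r z) / 2 * h j (T z x))" if "j \<in> J" "x \<in> space M" for j x
        unfolding u[OF that] v[OF that] ext
        by (simp add: distrib_right add_divide_distrib sum.distrib flip: sum_divide_distrib)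
    qed (use S R in auto)
  qed
  have C_shift: "(\<lambda>j x. u j (T y x)) \<in> C" if uC: "u \<in> C" for u y
  proof -
    obtain S p where S: "finite S" "\<forall>z. p z \<ge> 0" "\<forall>z. z \<notin> S \<longrightarrow> p z = 0" "(\<Sum>z\<in>S. p z) = 1"
      and u: "\<And>j x. j \<in> J \<Longrightarrow> x \<in> space M \<Longrightarrow> u j x = (\<Sum>z\<in>S. p z * h j (T z x))"
      using CE[OF uC] by blast
    have inj: "inj_on (\<lambda>z. z + y) S" by (simp add: inj_on_def)
    show ?thesis
    proof (rule CI[of "(\<lambda>z. z + y) ` S" "\<lambda>z. p (z - y)"])
      show "p (z - y) = 0" if "z \<notin> (\<lambda>z. z + y) ` S" for z
        using that S(3) by (metis diff_add_cancel imageI)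
      show "(\<Sum>z\<in>(\<lambda>z. z + y) ` S. p (z - y)) = 1"
        using S(4) by (simp add: sum.reindex[OF inj])
      show "u j (T y x) = (\<Sum>z\<in>(\<lambda>z. z + y) ` S. p (z - y) * h j (T z x))" if "j \<in> J" "x \<in> space M" for j x
        using u[OF that(1) measurable_space[OF T that(2)]] that
        by (simp add: sum.reindex[OF inj] action)
    qed (use S in auto)
  qed
  have "(\<lambda>j x. h j (T 0 x)) \<in> C"
    by (rule CI[of "{0}" "\<lambda>z. if z = 0 then 1 else 0"]) auto
  then have C_ne: "C \<noteq> {}" by blast
  have N_nonneg: "N u \<ge> 0" for u unfolding N_def by (intro sum_nonneg) simp
  have N_shift: "N (\<lambda>j x. u j (T y x)) = N u" if "u \<in> C" for u y
    unfolding N_def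
  proof (rule sum.cong[OF refl])
    fix j assume "j \<in> J"
    have "(\<lambda>x. (u j x)\<^sup>2) \<in> borel_measurable M" using C_meas[OF that \<open>j \<in> J\<close>] by simp
    from shift_integral[OF this] show "(\<integral>x. (u j (T y x))\<^sup>2 \<partial>M) = (\<integral>x. (u j x)\<^sup>2 \<partial>M)" .
  qed
  define m where "m = Inf (N ` C)"
  have bdd: "bdd_below (N ` C)" using N_nonneg by (intro bdd_belowI[of _ 0]) auto
  have m_le: "m \<le> N u" if "u \<in> C" for u
    unfolding m_def using that bdd by (intro cInf_lower) auto
  have near: "\<exists>u\<in>C. N u \<le> m + \<delta>" if "\<delta> > 0" for \<delta>
  proof -
    have "Inf (N ` C) < m + \<delta>" using that by (simp add: m_def)
    with cInf_lessD[of "N ` C"] C_ne show ?thesis by fastforce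
  qed
  have close: "(\<integral>x. (u j x - v j x)\<^sup>2 \<partial>M) \<le> 4 * \<delta>"
    if "u \<in> C" "v \<in> C" "N u \<le> m + \<delta>" "N v \<le> m + \<delta>" "j \<in> J" for u v \<delta> j
  proof -
    have par: "(\<integral>x. (u j x - v j x)\<^sup>2 \<partial>M)
      = 2 * (\<integral>x. (u j x)\<^sup>2 \<partial>M) + 2 * (\<integral>x. (v j x)\<^sup>2 \<partial>M) - 4 * (\<integral>x. ((u j x + v j x) / 2)\<^sup>2 \<partial>M)"
      if "j \<in> J" for j
    proof -
      have "(a - b)\<^sup>2 = 2 * a\<^sup>2 + 2 * b\<^sup>2 - 4 * ((a + b) / 2)\<^sup>2" for a b :: real
        by (simp add: power2_eq_square field_simps)
      then show ?thesis
        using C_int[OF \<open>u \<in> C\<close> that] C_int[OF \<open>v \<in> C\<close> that] C_int[OF C_mid[OF \<open>u \<in> C\<close> \<open>v \<in> C\<close>] that] by simp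
    qed
    have "(\<integral>x. (u j x - v j x)\<^sup>2 \<partial>M) \<le> (\<Sum>j\<in>J. \<integral>x. (u j x - v j x)\<^sup>2 \<partial>M)"
      using that \<open>finite J\<close> by (intro member_le_sum) auto
    also have "\<dots> = 2 * N u + 2 * N v - 4 * N (\<lambda>j x. (u j x + v j x) / 2)"
      unfolding N_def by (simp add: par sum.distrib sum_subtractf sum_distrib_left)
    also have "\<dots> \<le> 4 * \<delta>" using that m_le[OF C_mid[OF that(1,2)]] by simp
    finally show ?thesis .
  qed
  \<comment> \<open>Geometric decay makes the increments of the minimizing sequence summable almost surely;
    \<open>4 * \<delta> 0 = \<epsilon>\<close> is the bound wanted for its first element.\<close>
  define \<delta> where "\<delta> n = \<epsilon> / 4 * (1 / 4) ^ n" for n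
  have \<delta>_pos: "\<delta> n > 0" for n using \<open>\<epsilon> > 0\<close> by (simp add: \<delta>_def)
  have \<delta>_mono: "\<delta> n \<le> \<delta> k" if "k \<le> n" for k n
    unfolding \<delta>_def using that \<open>\<epsilon> > 0\<close> by (intro mult_left_mono power_decreasing) auto
  obtain u where u: "\<And>n. u n \<in> C" "\<And>n. N (u n) \<le> m + \<delta> n"
    using near[OF \<delta>_pos] by metis
  have u_close: "(\<integral>x. (u k j x - u n j x)\<^sup>2 \<partial>M) \<le> \<epsilon> * (1 / 4) ^ k" if "j \<in> J" "k \<le> n" for j k n
  proof -
    have "N (u n) \<le> m + \<delta> k" using u(2)[of n] \<delta>_mono[OF that(2)] by linarith
    from close[OF u(1) u(1) u(2) this that(1)] show ?thesis by (simp add: \<delta>_def)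
  qed
  have "(\<integral>x. (u 0 j x)\<^sup>2 \<partial>M) \<le> \<epsilon>" if j: "j \<in> J" for j
  proof -
    note [measurable] = C_meas[OF u(1) j] T
    note int = C_int[OF u(1) j]
    have "AE x in M. summable (\<lambda>n. \<bar>u n j x - u (Suc n) j x\<bar>)"
      using u_close[OF j, of _ "Suc _"] int
      by (intro AE_summable_if_square_expectation_geometric[where K = \<epsilon>] integrable_square_diff) auto
    then have conv: "AE x in M. (\<lambda>n. u n j x) \<longlonglongrightarrow> lim (\<lambda>n. u n j x)"
    proof eventually_elim
      case (elim x)
      have "summable (\<lambda>n. u n j x - u (Suc n) j x)" by (rule summable_rabs_cancel) fact
      then have "convergent (\<lambda>n. \<Sum>k<n. u k j x - u (Suc k) j x)" by (simp add: summable_iff_convergent)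
      then have "convergent (\<lambda>n. u 0 j x - u n j x)" 
        unfolding sum_lessThan_telescope'[of "\<lambda>n. u n j x"] .
      from convergent_diff[OF convergent_const[of "u 0 j x"] this] have "convergent (\<lambda>n. u n j x)"
        by (simp only: diff_diff_eq2 add_diff_cancel_left')
      then show ?case by (simp add: convergent_LIMSEQ_iff)
    qed
    define F where "F x = lim (\<lambda>n. u n j x)" for x
    have F[measurable]: "F \<in> borel_measurable M"
      unfolding F_def by (rule borel_measurable_lim_metric) simp
    have lim: "AE x in M. (\<lambda>n. u n j x) \<longlonglongrightarrow> F x" using conv by (simp add: F_def)
    have "AE x in M. F (T z x) = F x" for z
    proof -
      have "AE x in distr M M (T z). (\<lambda>n. u n j x) \<longlonglongrightarrow> F x"
        unfolding preserving by (rule lim)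
      then have 1: "AE x in M. (\<lambda>n. u n j (T z x)) \<longlonglongrightarrow> F (T z x)"
        by (rule AE_distrD[OF T])
      have "(\<integral>x. (u n j (T z x) - u n j x)\<^sup>2 \<partial>M) \<le> \<epsilon> * (1 / 4) ^ n" for n
        using close[OF C_shift[OF u(1)] u(1) _ u(2) j, of n z n] N_shift[OF u(1)] u(2)[of n]
        by (simp add: \<delta>_def)
      then have "AE x in M. summable (\<lambda>n. \<bar>u n j (T z x) - u n j x\<bar>)"
        using int shift_integrable[OF int]
        by (intro AE_summable_if_square_expectation_geometric[where K = \<epsilon>] integrable_square_diff) auto
      then show ?thesis using 1 lim
      proof eventually_elim
        case (elim x)
        have "(\<lambda>n. u n j (T z x) - u n j x) \<longlonglongrightarrow> 0"
          using summable_LIMSEQ_zero[OF elim(1)] by (rule tendsto_rabs_zero_cancel)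
        moreover have "(\<lambda>n. u n j (T z x) - u n j x) \<longlonglongrightarrow> F (T z x) - F x"
          by (intro tendsto_diff elim)
        ultimately show ?case using LIMSEQ_unique by fastforce
      qed
    qed
    then obtain c where c: "AE x in M. F x = c"
      using AE_constant_if_invariant[OF \<open>prob_space M\<close> T action ergodic F] by blast
    have "AE x in M. (\<lambda>n. u 0 j x - u n j x) \<longlonglongrightarrow> u 0 j x - c"
      using lim c by eventually_elim (auto intro!: tendsto_diff)
    then have "(\<integral>x. (u 0 j x - c)\<^sup>2 \<partial>M) \<le> \<epsilon>"
      using u_close[OF j, of 0] int
      by (intro square_integral_limit_le(2)[of "\<lambda>n x. u 0 j x - u n j x"] integrable_square_diff) auto
    moreover have "(\<integral>x. (u 0 j x - c)\<^sup>2 \<partial>M) = (\<integral>x. (u 0 j x)\<^sup>2 \<partial>M) + c\<^sup>2"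
    proof -
      have i1: "integrable M (u 0 j)" using square_integrable_imp_integrable[OF _ int] by simp
      show ?thesis using int[of 0] i1 C_mean[OF u(1)[of 0] j] by (simp add: power2_diff prob_space mult.assoc)
    qed
    ultimately show ?thesis using zero_le_power2[of c] by linarith
  qed
  moreover obtain S p where S: "finite S" "\<forall>z. p z \<ge> 0" "\<forall>z. z \<notin> S \<longrightarrow> p z = 0" "(\<Sum>z\<in>S. p z) = 1"
    and u0: "\<And>j x. j \<in> J \<Longrightarrow> x \<in> space M \<Longrightarrow> u 0 j x = (\<Sum>z\<in>S. p z * h j (T z x))"
    using CE[OF u(1)[of 0]] by blast
  moreover have "(\<integral>x. (\<Sum>z\<in>S. p z * h j (T z x))\<^sup>2 \<partial>M) = (\<integral>x. (u 0 j x)\<^sup>2 \<partial>M)" if "j \<in> J" for j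
    using u0[OF that] by (intro Bochner_Integration.integral_cong) auto
  ultimately show ?thesis using that[of S p] by auto
qed

section \<open>Riemann sums of random paths\<close>

lemma left_Riemann_sums_tendsto:
  fixes f :: "real \<Rightarrow> real"
  assumes "t > 0" and cont: "continuous_on {0..t} f"
  shows "(\<lambda>n. t / real (Suc n) * (\<Sum>k<Suc n. f (real k * t / real (Suc n)))) \<longlonglongrightarrow> integral {0..t} f"
proof (rule LIMSEQ_I)
  fix e :: real assume "e > 0"
  have "uniformly_continuous_on {0..t} f" using cont by (intro compact_uniformly_continuous) auto
  moreover have "e / (2 * t) > 0" using \<open>e > 0\<close> \<open>t > 0\<close> by simp
  ultimately obtain d where "d > 0"
    and d: "\<And>x y. x \<in> {0..t} \<Longrightarrow> y \<in> {0..t} \<Longrightarrow> dist y x < d \<Longrightarrow> dist (f y) (f x) < e / (2 * t)"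
    unfolding uniformly_continuous_on_def by metis
  obtain n0 :: nat where n0: "t / d < real n0" using reals_Archimedean2 by blast
  have "norm (t / real (Suc n) * (\<Sum>k<Suc n. f (real k * t / real (Suc n))) - integral {0..t} f) < e" if "n \<ge> n0" for n
  proof -
    define N where "N = real (Suc n)"
    define s where "s k = real k * t / N" for k
    have N: "N > 0" "N > real n0" using that by (auto simp: N_def)
    have "t / d < N" using n0 N(2) by linarith
    then have "t / N < d" using N(1) \<open>d > 0\<close> by (simp add: field_simps)
    have s_mono: "s k \<le> s (Suc k)" for k using N \<open>t > 0\<close> by (simp add: s_def field_simps)
    have s_step: "s (Suc k) - s k = t / N" for k by (simp add: s_def distrib_right add_divide_distrib)
    have s_0: "0 \<le> s k" for k using N \<open>t > 0\<close> by (simp add: s_def)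
    have s_le: "s k \<le> t" if "k \<le> Suc n" for k
      using that N \<open>t > 0\<close> by (simp add: s_def N_def divide_le_eq mult.commute)
    have piece: "\<bar>t / N * f (s k) - integral {s k..s (Suc k)} f\<bar> \<le> e / (2 * t) * (t / N)" if "k < Suc n" for k
    proof -
      have sub: "{s k..s (Suc k)} \<subseteq> {0..t}" using s_0[of k] s_le[of "Suc k"] that by auto
      have i: "f integrable_on {s k..s (Suc k)}"
        using continuous_on_subset[OF cont sub] by (rule integrable_continuous_interval)
      have "t / N * f (s k) - integral {s k..s (Suc k)} f = integral {s k..s (Suc k)} (\<lambda>x. f (s k) - f x)"
        using i s_mono[of k] by (subst integral_diff) (auto simp: s_step)
      also have "norm \<dots> \<le> integral {s k..s (Suc k)} (\<lambda>x. e / (2 * t))"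
      proof (rule integral_norm_bound_integral)
        fix x assume x: "x \<in> {s k..s (Suc k)}"
        then have "dist (s k) x < d" using s_step[of k] \<open>t / N < d\<close> by (simp add: dist_real_def)
        then show "norm (f (s k) - f x) \<le> e / (2 * t)"
          using d[of x "s k"] x sub s_mono[of k] by (force simp: dist_norm)
      qed (use i in \<open>auto intro: integrable_diff\<close>)
      also have "\<dots> = e / (2 * t) * (t / N)" using s_mono[of k] by (simp add: s_step)
      finally show ?thesis by simp
    qed
    have split: "integral {0..s k} f = (\<Sum>i<k. integral {s i..s (Suc i)} f)" if "k \<le> Suc n" for k
      using that
    proof (induction k)
      case 0
      then show ?case by (simp add: s_def)
    next
      case (Suc k)
      have "f integrable_on {0..s (Suc k)}"
        using s_le[OF Suc.prems] by (intro integrable_continuous_interval continuous_on_subset[OF cont]) auto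
      from Henstock_Kurzweil_Integration.integral_combine[OF s_0 s_mono this]
      show ?case using Suc by simp
    qed
    have "s (Suc n) = t" using N by (simp add: s_def N_def)
    then have "integral {0..t} f = (\<Sum>k<Suc n. integral {s k..s (Suc k)} f)"
      using split[of "Suc n"] by (simp only: order_refl)
    then have "t / N * (\<Sum>k<Suc n. f (s k)) - integral {0..t} f
      = (\<Sum>k<Suc n. t / N * f (s k) - integral {s k..s (Suc k)} f)"
      by (simp only: sum_distrib_left sum_subtractf)
    also have "\<bar>\<dots>\<bar> \<le> (\<Sum>k<Suc n. e / (2 * t) * (t / N))"
      by (rule order_trans[OF sum_abs]) (intro sum_mono piece, simp)
    also have "\<dots> = N * (e / (2 * t) * (t / N))" by (simp add: N_def)
    also have "\<dots> = e / 2" using N(1) \<open>t > 0\<close> by (simp add: field_simps)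
    also have "\<dots> < e" using \<open>e > 0\<close> by simp
    finally show ?thesis by (simp only: N_def s_def real_norm_def)
  qed
  then show "\<exists>n0. \<forall>n\<ge>n0. norm (t / real (Suc n) * (\<Sum>k<Suc n. f (real k * t / real (Suc n))) - integral {0..t} f) < e"
    by blast
qed

text \<open>The second moment of the time integral of a random path. The paths are continuous, so the integral
  is a limit of Riemann sums, and neither joint measurability nor Fubini's theorem is needed.\<close>

lemma path_integral_square_le:
  fixes F :: "real \<Rightarrow> 'a \<Rightarrow> real"
  assumes "t > 0"
    and F: "\<And>s. 0 \<le> s \<Longrightarrow> s \<le> t \<Longrightarrow> F s \<in> borel_measurable M"
      "\<And>s. 0 \<le> s \<Longrightarrow> s \<le> t \<Longrightarrow> integrable M (\<lambda>\<omega>. (F s \<omega>)\<^sup>2)"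
      "\<And>s. 0 \<le> s \<Longrightarrow> s \<le> t \<Longrightarrow> (\<integral>\<omega>. (F s \<omega>)\<^sup>2 \<partial>M) \<le> K"
    and cont: "AE \<omega> in M. continuous_on {0..t} (\<lambda>s. F s \<omega>)"
    and G: "G \<in> borel_measurable M" "AE \<omega> in M. G \<omega> = integral {0..t} (\<lambda>s. F s \<omega>)"
  shows "integrable M (\<lambda>\<omega>. (G \<omega>)\<^sup>2)" "(\<integral>\<omega>. (G \<omega>)\<^sup>2 \<partial>M) \<le> t\<^sup>2 * K"
proof -
  define R where "R n \<omega> = t / real (Suc n) * (\<Sum>k<Suc n. F (real k * t / real (Suc n)) \<omega>)" for n \<omega>
  have node: "0 \<le> real k * t / real (Suc n)" "real k * t / real (Suc n) \<le> t" if "k < Suc n" for k n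
    using that \<open>t > 0\<close> by (simp_all add: divide_le_eq mult.commute)
  have lim: "AE \<omega> in M. (\<lambda>n. R n \<omega>) \<longlonglongrightarrow> G \<omega>"
    using cont G(2)
  proof eventually_elim
    case (elim \<omega>)
    from left_Riemann_sums_tendsto[OF \<open>t > 0\<close> elim(1)] show ?case by (simp add: R_def elim(2))
  qed
  have meas: "R n \<in> borel_measurable M" for n
    unfolding R_def using F(1)[OF node] by (intro borel_measurable_times borel_measurable_const borel_measurable_sum) auto
  have int: "integrable M (\<lambda>\<omega>. (R n \<omega>)\<^sup>2)" for n
    unfolding R_def using F(1,2)[OF node] by (intro integrable_square_cmult integrable_square_sum) auto
  have bound: "(\<integral>\<omega>. (R n \<omega>)\<^sup>2 \<partial>M) \<le> t\<^sup>2 * K" for n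
  proof -
    let ?N = "real (Suc n)" and ?F = "\<lambda>k. F (real k * t / real (Suc n))"
    have pw: "(R n \<omega>)\<^sup>2 \<le> (t / ?N)\<^sup>2 * ((\<Sum>k<Suc n. (?F k \<omega>)\<^sup>2) * ?N)" for \<omega>
      unfolding R_def power_mult_distrib using sum_squared_le_sum_of_squares[of "\<lambda>k. ?F k \<omega>" "{..<Suc n}"]
      by (intro mult_left_mono) (simp_all del: sum.lessThan_Suc)
    have i: "integrable M (\<lambda>\<omega>. \<Sum>k<Suc n. (?F k \<omega>)\<^sup>2)"
      using F(2)[OF node] by (intro Bochner_Integration.integrable_sum) auto
    have "(\<integral>\<omega>. (R n \<omega>)\<^sup>2 \<partial>M) \<le> (\<integral>\<omega>. (t / ?N)\<^sup>2 * ((\<Sum>k<Suc n. (?F k \<omega>)\<^sup>2) * ?N) \<partial>M)"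
      using int i pw by (intro integral_mono integrable_mult_right integrable_mult_left) auto
    also have "\<dots> = (t / ?N)\<^sup>2 * ((\<integral>\<omega>. (\<Sum>k<Suc n. (?F k \<omega>)\<^sup>2) \<partial>M) * ?N)"
      by (simp del: sum.lessThan_Suc of_nat_Suc)
    also have "(\<integral>\<omega>. (\<Sum>k<Suc n. (?F k \<omega>)\<^sup>2) \<partial>M) = (\<Sum>k<Suc n. \<integral>\<omega>. (?F k \<omega>)\<^sup>2 \<partial>M)"
      using F(2)[OF node] by (intro Bochner_Integration.integral_sum) auto
    also have "(t / ?N)\<^sup>2 * ((\<Sum>k<Suc n. \<integral>\<omega>. (?F k \<omega>)\<^sup>2 \<partial>M) * ?N) \<le> (t / ?N)\<^sup>2 * ((\<Sum>k<Suc n. K) * ?N)"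
      using F(3)[OF node] by (intro mult_left_mono mult_right_mono sum_mono) auto
    also have "(\<Sum>k<Suc n. K) = ?N * K" by simp
    also have "(t / ?N)\<^sup>2 * (?N * K * ?N) = t\<^sup>2 * K"
    proof -
      have "(t / N)\<^sup>2 * (N * K * N) = t\<^sup>2 * K" if "N \<noteq> 0" for N
        using that by (simp add: power2_eq_square field_simps)
      from this[of ?N] show ?thesis by simp
    qed
    finally show ?thesis .
  qed
  show "integrable M (\<lambda>\<omega>. (G \<omega>)\<^sup>2)" "(\<integral>\<omega>. (G \<omega>)\<^sup>2 \<partial>M) \<le> t\<^sup>2 * K"
    by (rule square_integral_limit_le[OF meas G(1) lim int always_eventually], use bound in blast)+
qed

section \<open>The stationary dynamics\<close>

lemma brownian_motion_moments:
  assumes "standard_brownian_motion M W" "t > 0"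
  shows "integrable M (\<lambda>\<omega>. (W t \<omega>)\<^sup>2)" "(\<integral>\<omega>. (W t \<omega>)\<^sup>2 \<partial>M) = t"
    "integrable M (W t)" "(\<integral>\<omega>. W t \<omega> \<partial>M) = 0"
proof -
  interpret prob_space M using assms by (simp add: standard_brownian_motion_def)
  have [measurable]: "W t \<in> borel_measurable M" "W 0 \<in> borel_measurable M"
    using assms by (simp_all add: standard_brownian_motion_def)
  have "AE \<omega> in M. W 0 \<omega> = 0" using assms by (auto simp: standard_brownian_motion_def)
  then have eq: "AE \<omega> in M. W t \<omega> - W 0 \<omega> = W t \<omega>" by eventually_elim simp
  then have eq2: "AE \<omega> in M. (W t \<omega> - W 0 \<omega>)\<^sup>2 = (W t \<omega>)\<^sup>2" by eventually_elim simp
  have D: "distributed M lborel (\<lambda>\<omega>. W t \<omega> - W 0 \<omega>) (normal_density 0 (sqrt t))"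
    using assms unfolding standard_brownian_motion_def by force
  have E: "expectation (\<lambda>\<omega>. W t \<omega> - W 0 \<omega>) = 0"
    using normal_distributed_expectation[OF _ D] assms(2) by simp
  have V: "expectation (\<lambda>\<omega>. (W t \<omega> - W 0 \<omega>)\<^sup>2) = t"
    using normal_distributed_variance[OF _ D] assms(2) by (simp add: E)
  have I: "integrable M (\<lambda>\<omega>. (W t \<omega> - W 0 \<omega>)\<^sup>2)"
    using distributed_integrable[OF D, of "\<lambda>x. x\<^sup>2"] integrable_normal_moment[of "sqrt t" 0 2] assms(2) by simp
  show sq: "integrable M (\<lambda>\<omega>. (W t \<omega>)\<^sup>2)"
    by (rule integrable_cong_AE_imp[OF I]) (use eq2 in \<open>auto elim: eventually_mono\<close>)
  show "integrable M (W t)" by (rule square_integrable_imp_integrable[OF _ sq]) simp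
  show "expectation (\<lambda>\<omega>. (W t \<omega>)\<^sup>2) = t"
    using integral_cong_AE[OF _ _ eq2] V by simp
  show "expectation (\<lambda>\<omega>. W t \<omega>) = 0"
    using integral_cong_AE[OF _ _ eq] E by simp
qed

text \<open>Convergence in the weighted distance implies convergence of each bond variable. The summability
  of the differences matters here, since an infinite sum that does not converge is 0.\<close>

lemma weighted_fields_coordinate_le:
  assumes \<eta>: "\<eta> \<in> weighted_fields r" and \<zeta>: "\<zeta> \<in> weighted_fields r" and b: "b \<in> bonds"
  shows "\<bar>\<eta> b - \<zeta> b\<bar> \<le> exp (r * site_norm (fst b)) * weighted_dist r \<eta> \<zeta>"
proof -
  define m where "m b = exp (- 2 * r * site_norm (fst b))" for b :: "'a bond"
  have "(\<lambda>b. 2 * (\<bar>\<eta> b\<bar>\<^sup>2 * m b) + 2 * (\<bar>\<zeta> b\<bar>\<^sup>2 * m b)) summable_on bonds"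
    using \<eta> \<zeta> unfolding weighted_fields_def m_def by (intro summable_on_add summable_on_cmult_right) auto
  then have sm: "(\<lambda>b. \<bar>\<eta> b - \<zeta> b\<bar>\<^sup>2 * m b) summable_on bonds"
  proof (rule summable_on_comparison_test)
    fix b :: "'a bond"
    have "(x - y)\<^sup>2 \<le> 2 * x\<^sup>2 + 2 * y\<^sup>2" for x y :: real
      using sum_squares_ge_zero[of "x + y" 0] by (simp add: power2_eq_square algebra_simps)
    from mult_right_mono[OF this, of "m b" "\<eta> b" "\<zeta> b"]
    show "\<bar>\<eta> b - \<zeta> b\<bar>\<^sup>2 * m b \<le> 2 * (\<bar>\<eta> b\<bar>\<^sup>2 * m b) + 2 * (\<bar>\<zeta> b\<bar>\<^sup>2 * m b)"
      by (simp add: m_def algebra_simps)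
  qed (simp add: m_def)
  have "\<bar>\<eta> b - \<zeta> b\<bar>\<^sup>2 * m b \<le> (\<Sum>\<^sub>\<infinity>b\<in>bonds. \<bar>\<eta> b - \<zeta> b\<bar>\<^sup>2 * m b)"
    using finite_sum_le_infsum[OF sm, of "{b}"] b by (simp add: m_def)
  then have "sqrt (\<bar>\<eta> b - \<zeta> b\<bar>\<^sup>2 * m b) \<le> weighted_dist r \<eta> \<zeta>"
    unfolding weighted_dist_def m_def by (rule real_sqrt_le_mono)
  moreover have "sqrt (m b) = exp (- r * site_norm (fst b))"
    by (rule real_sqrt_unique) (simp_all add: m_def power2_eq_square flip: exp_add)
  ultimately have "\<bar>\<eta> b - \<zeta> b\<bar> * exp (- r * site_norm (fst b)) \<le> weighted_dist r \<eta> \<zeta>"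
    by (simp add: real_sqrt_mult)
  then have "exp (r * site_norm (fst b)) * (\<bar>\<eta> b - \<zeta> b\<bar> * exp (- r * site_norm (fst b)))
    \<le> exp (r * site_norm (fst b)) * weighted_dist r \<eta> \<zeta>"
    by (intro mult_left_mono) auto
  then show ?thesis by (simp add: exp_minus field_simps)
qed

text \<open>A solution of the gradient dynamics whose law at each time is the tempered measure \<open>\<mu>\<close>. Of the
  potential only the Lipschitz continuity of \<open>V'\<close> is used.\<close>

locale stationary_dynamics =
  fixes V :: "real \<Rightarrow> real" and L r :: real and M :: "'w measure"
    and w :: "real \<Rightarrow> 'd::finite site \<Rightarrow> 'w \<Rightarrow> real"
    and \<eta> :: "real \<Rightarrow> 'w \<Rightarrow> 'd bond_field" and \<mu> :: "'d bond_field measure"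
  assumes solution: "gradient_sde_solution V r M w \<eta>"
    and law: "\<And>t. t \<ge> 0 \<Longrightarrow> distr M gradient_space (\<eta> t) = \<mu>"
    and tempered: "tempered \<mu>"
    and Lipschitz: "\<And>u v. \<bar>deriv V u - deriv V v\<bar> \<le> L * \<bar>u - v\<bar>"
begin

lemma brownian: "brownian_family M w"
  using solution by (simp add: gradient_sde_solution_def)

sublocale prob_space M
  using brownian by (simp add: brownian_family_def)

lemma brownian_site: "standard_brownian_motion M (\<lambda>t. w t x)"
  using brownian by (simp add: brownian_family_def)

lemma measurable_noise: "t \<ge> 0 \<Longrightarrow> w t x \<in> borel_measurable M"
  using brownian_site[of x] by (simp add: standard_brownian_motion_def)

lemma measurable_state: "t \<ge> 0 \<Longrightarrow> \<eta> t \<in> M \<rightarrow>\<^sub>M gradient_space"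
  using solution by (simp add: gradient_sde_solution_def)

lemma sets_law [measurable_cong]: "sets \<mu> = sets gradient_space"
  using law[of 0, symmetric] by simp

lemma measurable_law: "borel_measurable \<mu> = borel_measurable gradient_space"
  by (rule measurable_cong_sets[OF sets_law refl])

sublocale \<mu>: prob_space \<mu>
  using prob_space_distr[OF measurable_state[of 0]] law[of 0] by simp

lemma measurable_observable:
  "f \<in> borel_measurable \<mu> \<Longrightarrow> t \<ge> 0 \<Longrightarrow> (\<lambda>\<omega>. f (\<eta> t \<omega>)) \<in> borel_measurable M"
  using measurable_compose[OF measurable_state] by (simp add: measurable_law)

lemma integral_observable:
  fixes f :: "'d bond_field \<Rightarrow> real"
  assumes "f \<in> borel_measurable \<mu>" "t \<ge> 0"
  shows "(\<integral>\<omega>. f (\<eta> t \<omega>) \<partial>M) = (\<integral>\<zeta>. f \<zeta> \<partial>\<mu>)"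
  using integral_distr[OF measurable_state[OF assms(2)], of f] assms law[OF assms(2)]
  by (simp add: measurable_law)

lemma integrable_observable:
  fixes f :: "'d bond_field \<Rightarrow> real"
  assumes "integrable \<mu> f" "t \<ge> 0"
  shows "integrable M (\<lambda>\<omega>. f (\<eta> t \<omega>))"
  using integrable_distr[OF measurable_state[OF assms(2)], of f] assms law[OF assms(2)] by simp

lemma measurable_law_bond: "b \<in> bonds \<Longrightarrow> (\<lambda>\<zeta>. \<zeta> b) \<in> borel_measurable \<mu>"
  by (simp add: measurable_law measurable_bond)

lemma square_integrable_bond: "b \<in> bonds \<Longrightarrow> integrable \<mu> (\<lambda>\<zeta>. (\<zeta> b)\<^sup>2)"
  using tempered by (simp add: tempered_def)

lemma Lipschitz_nonneg: "L \<ge> 0"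
  using Lipschitz[of 1 0] by simp

lemma continuous_deriv: "continuous_on A (deriv V)"
proof -
  have "L-lipschitz_on A (deriv V)"
    by (rule lipschitz_onI) (use Lipschitz Lipschitz_nonneg in \<open>auto simp: dist_real_def\<close>)
  then show ?thesis by (rule lipschitz_on_continuous_on)
qed

lemma measurable_deriv [measurable]: "deriv V \<in> borel_measurable borel"
  by (rule borel_measurable_continuous_onI[OF continuous_deriv])

lemma continuous_paths: "AE \<omega> in M. \<forall>b\<in>bonds. continuous_on {0..} (\<lambda>s. \<eta> s \<omega> b)"
proof -
  have "AE \<omega> in M. (\<forall>t\<ge>0. \<eta> t \<omega> \<in> weighted_fields r)
          \<and> (\<forall>t\<ge>0. ((\<lambda>s. weighted_dist r (\<eta> s \<omega>) (\<eta> t \<omega>)) \<longlongrightarrow> 0) (at t within {0..}))"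
    using solution unfolding gradient_sde_solution_def by (auto elim!: eventually_mono)
  then show ?thesis
  proof eventually_elim
    case (elim \<omega>)
    show ?case
    proof (intro ballI)
      fix b :: "'d bond" assume b: "b \<in> bonds"
      let ?e = "exp (r * site_norm (fst b))"
      show "continuous_on {0..} (\<lambda>s. \<eta> s \<omega> b)"
        unfolding continuous_on_def
      proof (intro ballI)
        fix t :: real assume "t \<in> {0..}"
        then have t: "t \<ge> 0" by simp
        have "((\<lambda>s. ?e * weighted_dist r (\<eta> s \<omega>) (\<eta> t \<omega>)) \<longlongrightarrow> ?e * 0) (at t within {0..})"
          using elim t by (intro tendsto_intros) auto
        then have "((\<lambda>s. ?e * weighted_dist r (\<eta> s \<omega>) (\<eta> t \<omega>)) \<longlongrightarrow> 0) (at t within {0..})" by simp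
        moreover have "\<forall>\<^sub>F s in at t within {0..}. norm (\<eta> s \<omega> b - \<eta> t \<omega> b) \<le> ?e * weighted_dist r (\<eta> s \<omega>) (\<eta> t \<omega>)"
          using elim t b unfolding eventually_at_filter
          by (intro always_eventually allI impI) (simp add: weighted_fields_coordinate_le)
        ultimately have "((\<lambda>s. \<eta> s \<omega> b - \<eta> t \<omega> b) \<longlongrightarrow> 0) (at t within {0..})"
          by (rule Lim_null_comparison[rotated])
        then show "((\<lambda>s. \<eta> s \<omega> b) \<longlongrightarrow> \<eta> t \<omega> b) (at t within {0..})"
          by (simp add: LIM_zero_iff)
      qed
    qed
  qed
qed

lemma continuous_site_force:
  assumes "\<forall>b\<in>bonds. continuous_on {0..} (\<lambda>s. \<eta> s \<omega> b)"
  shows "continuous_on {0..} (\<lambda>s. site_force V (\<eta> s \<omega>) x)"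
  unfolding site_force_eq_sum_neighbours
  using assms
  by (intro continuous_on_sum continuous_on_compose2[OF continuous_deriv[of UNIV]]) (auto simp: mem_bonds_iff)

text \<open>The evolution of a finite linear combination of bond variables which represents the weighted sum of
  heights with weights \<open>q\<close>.\<close>

lemma evolution:
  assumes rep: "\<And>\<phi>. (\<Sum>b\<in>B. c b * grad \<phi> b) = (\<Sum>y\<in>S. q y * \<phi> y)" and "finite B" "B \<subseteq> bonds"
  shows "AE \<omega> in M. \<forall>t\<ge>0. (\<Sum>b\<in>B. c b * \<eta> t \<omega> b) = (\<Sum>b\<in>B. c b * \<eta> 0 \<omega> b)
     - integral {0..t} (\<lambda>s. \<Sum>y\<in>S. q y * site_force V (\<eta> s \<omega>) y) + sqrt 2 * (\<Sum>y\<in>S. q y * w t y \<omega>)"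
proof -
  have "AE \<omega> in M. \<forall>t\<ge>0. \<forall>b\<in>bonds. \<eta> t \<omega> b = \<eta> 0 \<omega> b
               - integral {0..t} (\<lambda>s. grad (site_force V (\<eta> s \<omega>)) b)
               + sqrt 2 * grad (\<lambda>x. w t x \<omega>) b"
    using solution unfolding gradient_sde_solution_def by (auto elim!: eventually_mono)
  then show ?thesis
    using continuous_paths
  proof eventually_elim
    case (elim \<omega>)
    show ?case
    proof (intro allI impI)
      fix t :: real assume t: "t \<ge> 0"
      have i: "(\<lambda>s. grad (site_force V (\<eta> s \<omega>)) b) integrable_on {0..t}" if "b \<in> B" for b
        using that assms(3) unfolding grad_def
        by (intro integrable_continuous_interval continuous_on_subset[of "{0..}" _ "{0..t}"])
          (auto intro!: continuous_on_diff continuous_site_force elim)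
      have "(\<Sum>b\<in>B. c b * \<eta> t \<omega> b) = (\<Sum>b\<in>B. c b * (\<eta> 0 \<omega> b
               - integral {0..t} (\<lambda>s. grad (site_force V (\<eta> s \<omega>)) b)
               + sqrt 2 * grad (\<lambda>x. w t x \<omega>) b))"
        using elim(1) t assms(3) by (intro sum.cong refl arg_cong[where f = "(*) _"]) blast
      also have "\<dots> = (\<Sum>b\<in>B. c b * \<eta> 0 \<omega> b)
          - (\<Sum>b\<in>B. c b * integral {0..t} (\<lambda>s. grad (site_force V (\<eta> s \<omega>)) b))
          + sqrt 2 * (\<Sum>b\<in>B. c b * grad (\<lambda>x. w t x \<omega>) b)"
        by (simp add: algebra_simps sum.distrib sum_subtractf sum_distrib_left)
      also have "(\<Sum>b\<in>B. c b * integral {0..t} (\<lambda>s. grad (site_force V (\<eta> s \<omega>)) b))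
          = integral {0..t} (\<lambda>s. \<Sum>b\<in>B. c b * grad (site_force V (\<eta> s \<omega>)) b)"
        using i \<open>finite B\<close> by (subst integral_sum) (auto intro: integrable_on_mult_right)
      finally show "(\<Sum>b\<in>B. c b * \<eta> t \<omega> b) = (\<Sum>b\<in>B. c b * \<eta> 0 \<omega> b)
         - integral {0..t} (\<lambda>s. \<Sum>y\<in>S. q y * site_force V (\<eta> s \<omega>) y) + sqrt 2 * (\<Sum>y\<in>S. q y * w t y \<omega>)"
        unfolding rep .
    qed
  qed
qed

lemma square_integrable_deriv:
  assumes b: "b \<in> bonds"
  shows "integrable \<mu> (\<lambda>\<zeta>. (deriv V (\<zeta> b))\<^sup>2)"
proof (rule Bochner_Integration.integrable_bound)
  show "integrable \<mu> (\<lambda>\<zeta>. 2 * L\<^sup>2 * (\<zeta> b)\<^sup>2 + 2 * (deriv V 0)\<^sup>2)"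
    using square_integrable_bond[OF b] by simp
  show "(\<lambda>\<zeta>. (deriv V (\<zeta> b))\<^sup>2) \<in> borel_measurable \<mu>"
    using measurable_compose[OF measurable_law_bond[OF b] measurable_deriv] by simp
  have "(deriv V u)\<^sup>2 \<le> 2 * L\<^sup>2 * u\<^sup>2 + 2 * (deriv V 0)\<^sup>2" for u
  proof -
    have sq: "(x + y)\<^sup>2 \<le> 2 * x\<^sup>2 + 2 * y\<^sup>2" for x y :: real
      using zero_le_power2[of "x - y"] by (simp add: power2_eq_square algebra_simps)
    have "\<bar>deriv V u - deriv V 0\<bar>\<^sup>2 \<le> (L * \<bar>u\<bar>)\<^sup>2"
      using Lipschitz[of u 0] by (intro power_mono) auto
    then show ?thesis using sq[of "deriv V u - deriv V 0" "deriv V 0"] by (simp add: power_mult_distrib)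
  qed
  then show "AE \<zeta> in \<mu>. norm ((deriv V (\<zeta> b))\<^sup>2) \<le> norm (2 * L\<^sup>2 * (\<zeta> b)\<^sup>2 + 2 * (deriv V 0)\<^sup>2)"
    by (intro AE_I2) simp
qed

lemma measurable_law_deriv: "b \<in> bonds \<Longrightarrow> (\<lambda>\<zeta>. deriv V (\<zeta> b)) \<in> borel_measurable \<mu>"
  using measurable_compose[OF measurable_law_bond measurable_deriv] .

lemma measurable_force: "(\<lambda>\<zeta>. \<Sum>y\<in>S. q y * site_force V \<zeta> y) \<in> borel_measurable \<mu>"
  unfolding site_force_eq_sum_neighbours
  by (intro borel_measurable_sum borel_measurable_times borel_measurable_const measurable_law_deriv)
    (simp add: mem_bonds_iff)

lemma square_integrable_force:
  assumes "finite S"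
  shows "integrable \<mu> (\<lambda>\<zeta>. (\<Sum>y\<in>S. q y * site_force V \<zeta> y)\<^sup>2)"
  unfolding site_force_eq_sum_neighbours
  using assms finite_neighbours
  by (intro integrable_square_sum integrable_square_cmult square_integrable_deriv borel_measurable_sum
      borel_measurable_times borel_measurable_const measurable_law_deriv)
    (auto simp: mem_bonds_iff)

lemma measurable_linear: "B \<subseteq> bonds \<Longrightarrow> (\<lambda>\<zeta>. \<Sum>b\<in>B. c b * \<zeta> b) \<in> borel_measurable \<mu>"
  by (intro borel_measurable_sum borel_measurable_times borel_measurable_const measurable_law_bond) auto

lemma square_integrable_linear:
  "finite B \<Longrightarrow> B \<subseteq> bonds \<Longrightarrow> integrable \<mu> (\<lambda>\<zeta>. (\<Sum>b\<in>B. c b * \<zeta> b)\<^sup>2)"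
  by (intro integrable_square_sum integrable_square_cmult square_integrable_bond
      borel_measurable_times borel_measurable_const measurable_law_bond) auto

text \<open>This crude bound, which ignores the independence of the Brownian motions at different sites, is
  enough: the weights used below have total absolute mass at most 2.\<close>

lemma noise_second_moment:
  assumes "finite S" "t > 0"
  shows "integrable M (\<lambda>\<omega>. (\<Sum>y\<in>S. q y * w t y \<omega>)\<^sup>2)"
    "(\<integral>\<omega>. (\<Sum>y\<in>S. q y * w t y \<omega>)\<^sup>2 \<partial>M) \<le> (\<Sum>y\<in>S. \<bar>q y\<bar>)\<^sup>2 * t"
proof -
  note W = brownian_motion_moments[OF brownian_site assms(2)]
  show int: "integrable M (\<lambda>\<omega>. (\<Sum>y\<in>S. q y * w t y \<omega>)\<^sup>2)"
    using assms W by (intro integrable_square_sum integrable_square_cmult) (auto intro!: measurable_noise)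
  have "(\<Sum>y\<in>S. q y * w t y \<omega>)\<^sup>2 \<le> (\<Sum>y\<in>S. \<bar>q y\<bar>) * (\<Sum>y\<in>S. \<bar>q y\<bar> * (w t y \<omega>)\<^sup>2)" for \<omega>
  proof -
    have eq: "q y * w t y \<omega> = sqrt \<bar>q y\<bar> * (sgn (q y) * sqrt \<bar>q y\<bar> * w t y \<omega>)" for y
    proof -
      have "q y = sgn (q y) * (sqrt \<bar>q y\<bar> * sqrt \<bar>q y\<bar>)" by (simp add: sgn_mult_abs)
      then show ?thesis by (metis mult.assoc mult.commute)
    qed
    have sq: "(sgn (q y) * sqrt \<bar>q y\<bar> * w t y \<omega>)\<^sup>2 = \<bar>q y\<bar> * (w t y \<omega>)\<^sup>2" for y
      by (cases "q y = 0") (simp_all add: power_mult_distrib power2_eq_square sgn_if)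
    show ?thesis
      unfolding eq by (rule order_trans[OF Cauchy_Schwarz_ineq_sum]) (simp add: sq)
  qed
  then have "(\<integral>\<omega>. (\<Sum>y\<in>S. q y * w t y \<omega>)\<^sup>2 \<partial>M)
      \<le> (\<integral>\<omega>. (\<Sum>y\<in>S. \<bar>q y\<bar>) * (\<Sum>y\<in>S. \<bar>q y\<bar> * (w t y \<omega>)\<^sup>2) \<partial>M)"
    using int W by (intro integral_mono) auto
  also have "\<dots> = (\<Sum>y\<in>S. \<bar>q y\<bar>) * (\<Sum>y\<in>S. \<bar>q y\<bar> * t)"
    using W by simp
  also have "\<dots> = (\<Sum>y\<in>S. \<bar>q y\<bar>)\<^sup>2 * t" by (simp add: power2_eq_square flip: sum_distrib_right)
  finally show "(\<integral>\<omega>. (\<Sum>y\<in>S. q y * w t y \<omega>)\<^sup>2 \<partial>M) \<le> (\<Sum>y\<in>S. \<bar>q y\<bar>)\<^sup>2 * t" .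
qed

lemma noise_uncorrelated:
  fixes f :: "'d bond_field \<Rightarrow> real"
  assumes f: "f \<in> borel_measurable \<mu>" "integrable \<mu> f" and "finite S" "t > 0"
  shows "integrable M (\<lambda>\<omega>. f (\<eta> 0 \<omega>) * (\<Sum>y\<in>S. q y * w t y \<omega>))"
    "(\<integral>\<omega>. f (\<eta> 0 \<omega>) * (\<Sum>y\<in>S. q y * w t y \<omega>) \<partial>M) = 0"
proof -
  let ?I = "{0::real..} \<times> (UNIV :: 'd site set)"
  let ?P = "(\<Pi>\<^sub>M p\<in>?I. borel) :: (real \<times> 'd site \<Rightarrow> real) measure"
  let ?N = "\<lambda>\<omega>. \<lambda>p\<in>?I. w (fst p) (snd p) \<omega>"
  note W = brownian_motion_moments[OF brownian_site assms(4)]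
  let ?A = "vimage_algebra (space M) (\<eta> 0) gradient_space" and ?B = "vimage_algebra (space M) ?N ?P"
  have "\<eta> 0 \<in> ?A \<rightarrow>\<^sub>M gradient_space"
    using measurable_space[OF measurable_state[of 0]] by (intro measurable_vimage_algebra1) auto
  then have fA: "(\<lambda>\<omega>. f (\<eta> 0 \<omega>)) \<in> borel_measurable ?A"
    by (rule measurable_compose) (use f(1) in \<open>simp add: measurable_law\<close>)
  have "?N \<in> ?B \<rightarrow>\<^sub>M ?P" by (rule measurable_vimage_algebra1) (auto simp: space_PiM)
  then have "(\<lambda>\<omega>. ?N \<omega> (t, y)) \<in> borel_measurable ?B" for y
    by (rule measurable_compose) (use assms(4) in \<open>auto intro!: measurable_component_singleton\<close>)
  then have wB: "w t y \<in> borel_measurable ?B" for y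
    using assms(4) by simp
  have sub: "sigma_sets (space M) {X -` A \<inter> space M |A. A \<in> sets borel} \<subseteq> sets N"
    if "X \<in> borel_measurable N" "space N = space M" for X :: "'w \<Rightarrow> real" and N
    using measurable_sets[OF that(1)] unfolding that(2)[symmetric] by (intro sets.sigma_sets_subset) auto
  have "indep_set (sets ?A) (sets ?B)"
    using solution by (simp add: gradient_sde_solution_def)
  then have "indep_set (sigma_sets (space M) {(\<lambda>\<omega>. f (\<eta> 0 \<omega>)) -` A \<inter> space M |A. A \<in> sets borel})
    (sigma_sets (space M) {w t y -` A \<inter> space M |A. A \<in> sets borel})" for y
    unfolding indep_set_def
    by (rule indep_sets_mono_sets) (use sub[OF fA] sub[OF wB[of y]] in \<open>simp split: bool.split\<close>)
  then have ind: "indep_var borel (\<lambda>\<omega>. f (\<eta> 0 \<omega>)) borel (w t y)" for y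
    unfolding indep_var_eq using measurable_observable[OF f(1)] measurable_noise assms(4) by simp
  have i: "integrable M (\<lambda>\<omega>. f (\<eta> 0 \<omega>) * w t y \<omega>)" for y
    by (rule indep_var_integrable[OF ind integrable_observable[OF f(2)] W(3)]) simp
  have e: "(\<integral>\<omega>. f (\<eta> 0 \<omega>) * w t y \<omega> \<partial>M) = 0" for y
    using indep_var_lebesgue_integral[OF ind integrable_observable[OF f(2)] W(3)] W(4) by simp
  have eq: "f (\<eta> 0 \<omega>) * (\<Sum>y\<in>S. q y * w t y \<omega>) = (\<Sum>y\<in>S. q y * (f (\<eta> 0 \<omega>) * w t y \<omega>))" for \<omega>
    by (simp add: sum_distrib_left mult.left_commute)
  show "integrable M (\<lambda>\<omega>. f (\<eta> 0 \<omega>) * (\<Sum>y\<in>S. q y * w t y \<omega>))"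
    "(\<integral>\<omega>. f (\<eta> 0 \<omega>) * (\<Sum>y\<in>S. q y * w t y \<omega>) \<partial>M) = 0"
    unfolding eq using i e by simp_all
qed

text \<open>The accumulated drift \<open>A\<close> is expressed by the endpoints of the path and the noise, which makes it
  measurable; it agrees with the time integral almost surely.\<close>

lemma drift_second_moment:
  assumes rep: "\<And>\<phi>. (\<Sum>b\<in>B. c b * grad \<phi> b) = (\<Sum>y\<in>S. q y * \<phi> y)"
    and B: "finite B" "B \<subseteq> bonds" and "finite S" "t > 0"
  defines "A \<equiv> \<lambda>\<omega>. (\<Sum>b\<in>B. c b * \<eta> 0 \<omega> b) - (\<Sum>b\<in>B. c b * \<eta> t \<omega> b) + sqrt 2 * (\<Sum>y\<in>S. q y * w t y \<omega>)"
  shows "A \<in> borel_measurable M"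
    "AE \<omega> in M. A \<omega> = integral {0..t} (\<lambda>s. \<Sum>y\<in>S. q y * site_force V (\<eta> s \<omega>) y)"
    "AE \<omega> in M. continuous_on {0..t} (\<lambda>s. \<Sum>y\<in>S. q y * site_force V (\<eta> s \<omega>) y)"
    "integrable M (\<lambda>\<omega>. (A \<omega>)\<^sup>2)"
    "(\<integral>\<omega>. (A \<omega>)\<^sup>2 \<partial>M) \<le> t\<^sup>2 * (\<integral>\<zeta>. (\<Sum>y\<in>S. q y * site_force V \<zeta> y)\<^sup>2 \<partial>\<mu>)"
proof -
  have m: "(\<lambda>\<omega>. \<Sum>b\<in>B. c b * \<eta> s \<omega> b) \<in> borel_measurable M" if "s \<ge> 0" for s
    using measurable_observable[OF measurable_linear[OF B(2)] that] .
  have mN: "(\<lambda>\<omega>. \<Sum>y\<in>S. q y * w t y \<omega>) \<in> borel_measurable M"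
    using \<open>t > 0\<close> by (intro borel_measurable_sum borel_measurable_times borel_measurable_const measurable_noise) auto
  show A: "A \<in> borel_measurable M"
    unfolding A_def using m mN \<open>t > 0\<close>
    by (intro borel_measurable_add borel_measurable_diff borel_measurable_times borel_measurable_const) auto
  show AE: "AE \<omega> in M. A \<omega> = integral {0..t} (\<lambda>s. \<Sum>y\<in>S. q y * site_force V (\<eta> s \<omega>) y)"
    using evolution[OF rep B]
  proof eventually_elim
    case (elim \<omega>)
    from elim[rule_format, OF less_imp_le[OF \<open>t > 0\<close>]] show ?case unfolding A_def by linarith
  qed
  show cont: "AE \<omega> in M. continuous_on {0..t} (\<lambda>s. \<Sum>y\<in>S. q y * site_force V (\<eta> s \<omega>) y)"
    using continuous_paths
  proof eventually_elim
    case (elim \<omega>)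
    have "continuous_on {0..} (\<lambda>s. \<Sum>y\<in>S. q y * site_force V (\<eta> s \<omega>) y)"
      by (intro continuous_on_sum continuous_on_mult continuous_on_const continuous_site_force elim)
    then show ?case by (rule continuous_on_subset) auto
  qed
  note Q = measurable_force[where S = S and q = q] square_integrable_force[OF \<open>finite S\<close>, where q = q]
  have sq: "(\<lambda>\<zeta>. (\<Sum>y\<in>S. q y * site_force V \<zeta> y)\<^sup>2) \<in> borel_measurable \<mu>" using Q(1) by simp
  show "integrable M (\<lambda>\<omega>. (A \<omega>)\<^sup>2)"
    "(\<integral>\<omega>. (A \<omega>)\<^sup>2 \<partial>M) \<le> t\<^sup>2 * (\<integral>\<zeta>. (\<Sum>y\<in>S. q y * site_force V \<zeta> y)\<^sup>2 \<partial>\<mu>)"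
    using path_integral_square_le[OF \<open>t > 0\<close> measurable_observable[OF Q(1)] integrable_observable[OF Q(2)] _ cont A AE]
      integral_observable[OF sq] by auto
qed

text \<open>Observables whose mean square displacement in short time is at most linear. The increment is taken
  from time 0 only, and only for times up to 1.\<close>

definition mean_square_Lipschitz :: "('d bond_field \<Rightarrow> real) \<Rightarrow> bool" where
  "mean_square_Lipschitz f \<longleftrightarrow> f \<in> borel_measurable \<mu> \<and> integrable \<mu> (\<lambda>\<zeta>. (f \<zeta>)\<^sup>2) \<and>
     (\<exists>D\<ge>0. \<forall>t. 0 < t \<and> t \<le> 1 \<longrightarrow> (\<integral>\<omega>. (f (\<eta> t \<omega>) - f (\<eta> 0 \<omega>))\<^sup>2 \<partial>M) \<le> D * t)"

lemma integrable_increment: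
  fixes f :: "'d bond_field \<Rightarrow> real"
  assumes "f \<in> borel_measurable \<mu>" "integrable \<mu> (\<lambda>\<zeta>. (f \<zeta>)\<^sup>2)" "s \<ge> 0"
  shows "integrable M (\<lambda>\<omega>. (f (\<eta> s \<omega>) - f (\<eta> 0 \<omega>))\<^sup>2)"
  using assms
  by (intro integrable_square_diff measurable_observable[OF assms(1)] integrable_observable[OF assms(2)]) auto

lemma mean_square_Lipschitz_bond:
  assumes b: "b \<in> bonds"
  shows "mean_square_Lipschitz (\<lambda>\<zeta>. \<zeta> b)"
proof -
  obtain x y where xy: "b = (x, y)" by (cases b)
  have "x \<noteq> y" using b by (auto simp: xy bonds_def site_norm_def zero_vec_def[symmetric])
  define q where "q z = (if z = x then 1 else - 1 :: real)" for z
  have rep: "(\<Sum>b\<in>{b}. 1 * grad \<phi> b) = (\<Sum>z\<in>{x, y}. q z * \<phi> z)" for \<phi>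
    using b \<open>x \<noteq> y\<close> by (simp add: xy q_def grad_def)
  define K where "K = (\<integral>\<zeta>. (\<Sum>z\<in>{x, y}. q z * site_force V \<zeta> z)\<^sup>2 \<partial>\<mu>)"
  have "K \<ge> 0" by (simp add: K_def)
  have "(\<integral>\<omega>. (\<eta> t \<omega> b - \<eta> 0 \<omega> b)\<^sup>2 \<partial>M) \<le> (2 * K + 16) * t" if t: "0 < t" "t \<le> 1" for t
  proof -
    define N where "N \<omega> = (\<Sum>z\<in>{x, y}. q z * w t z \<omega>)" for \<omega>
    define A where "A \<omega> = (\<Sum>b\<in>{b}. 1 * \<eta> 0 \<omega> b) - (\<Sum>b\<in>{b}. 1 * \<eta> t \<omega> b) + sqrt 2 * N \<omega>" for \<omega>
    have A: "integrable M (\<lambda>\<omega>. (A \<omega>)\<^sup>2)" "(\<integral>\<omega>. (A \<omega>)\<^sup>2 \<partial>M) \<le> t\<^sup>2 * K"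
      unfolding A_def N_def K_def
      using drift_second_moment(4,5)[where B = "{b}" and c = "\<lambda>_. 1" and S = "{x, y}" and q = q and t = t, OF rep] b t by auto
    have "(\<Sum>z\<in>{x, y}. \<bar>q z\<bar>) = 2" using \<open>x \<noteq> y\<close> by (simp add: q_def)
    then have N: "integrable M (\<lambda>\<omega>. (N \<omega>)\<^sup>2)" "(\<integral>\<omega>. (N \<omega>)\<^sup>2 \<partial>M) \<le> 4 * t"
      unfolding N_def using noise_second_moment[of "{x, y}" t q] t by auto
    have "(\<eta> t \<omega> b - \<eta> 0 \<omega> b)\<^sup>2 \<le> 2 * (A \<omega>)\<^sup>2 + 4 * (N \<omega>)\<^sup>2" for \<omega>
    proof -
      have "(u - v)\<^sup>2 \<le> 2 * v\<^sup>2 + 2 * u\<^sup>2" for u v :: real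
        using zero_le_power2[of "u + v"] by (simp add: power2_eq_square algebra_simps)
      from this[of "sqrt 2 * N \<omega>" "A \<omega>"] show ?thesis by (simp add: A_def power_mult_distrib)
    qed
    then have "(\<integral>\<omega>. (\<eta> t \<omega> b - \<eta> 0 \<omega> b)\<^sup>2 \<partial>M) \<le> (\<integral>\<omega>. 2 * (A \<omega>)\<^sup>2 + 4 * (N \<omega>)\<^sup>2 \<partial>M)"
      using A(1) N(1) b t integrable_increment[OF measurable_law_bond[OF b] square_integrable_bond[OF b], of t]
      by (intro integral_mono) auto
    also have "\<dots> \<le> 2 * (t\<^sup>2 * K) + 4 * (4 * t)" using A N by simp
    also have "\<dots> \<le> 2 * (t * K) + 4 * (4 * t)"
      using t \<open>K \<ge> 0\<close> by (intro add_mono mult_left_mono mult_right_mono) (auto simp: power2_eq_square mult_le_cancel_left1)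
    finally show ?thesis by (simp add: algebra_simps)
  qed
  then show ?thesis
    unfolding mean_square_Lipschitz_def using measurable_law_bond[OF b] square_integrable_bond[OF b] \<open>K \<ge> 0\<close>
    by (intro conjI exI[of _ "2 * K + 16"]) auto
qed

lemma mean_square_Lipschitz_deriv:
  assumes b: "b \<in> bonds"
  shows "mean_square_Lipschitz (\<lambda>\<zeta>. deriv V (\<zeta> b))"
proof -
  obtain D where D: "D \<ge> 0" "\<And>t. 0 < t \<Longrightarrow> t \<le> 1 \<Longrightarrow> (\<integral>\<omega>. (\<eta> t \<omega> b - \<eta> 0 \<omega> b)\<^sup>2 \<partial>M) \<le> D * t"
    using mean_square_Lipschitz_bond[OF b] unfolding mean_square_Lipschitz_def by blast
  have "(\<integral>\<omega>. (deriv V (\<eta> t \<omega> b) - deriv V (\<eta> 0 \<omega> b))\<^sup>2 \<partial>M) \<le> (L\<^sup>2 * D) * t" if t: "0 < t" "t \<le> 1" for t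
  proof -
    have "(deriv V u - deriv V v)\<^sup>2 \<le> L\<^sup>2 * (u - v)\<^sup>2" for u v
      using power_mono[OF Lipschitz[of u v], of 2] by (simp add: power_mult_distrib)
    then have "(\<integral>\<omega>. (deriv V (\<eta> t \<omega> b) - deriv V (\<eta> 0 \<omega> b))\<^sup>2 \<partial>M) \<le> (\<integral>\<omega>. L\<^sup>2 * (\<eta> t \<omega> b - \<eta> 0 \<omega> b)\<^sup>2 \<partial>M)"
      using integrable_increment[OF measurable_law_bond[OF b] square_integrable_bond[OF b], of t]
        integrable_increment[OF measurable_law_deriv[OF b] square_integrable_deriv[OF b], of t] t
      by (intro integral_mono) auto
    also have "\<dots> \<le> L\<^sup>2 * (D * t)" using D(2)[OF t] by (simp add: mult_left_mono)
    finally show ?thesis by (simp add: mult.assoc)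
  qed
  then show ?thesis
    unfolding mean_square_Lipschitz_def using measurable_law_deriv[OF b] square_integrable_deriv[OF b] D(1)
    by (intro conjI exI[of _ "L\<^sup>2 * D"]) auto
qed

lemma mean_square_Lipschitz_cmult:
  assumes "mean_square_Lipschitz f"
  shows "mean_square_Lipschitz (\<lambda>\<zeta>. a * f \<zeta>)"
proof -
  obtain D where f: "f \<in> borel_measurable \<mu>" "integrable \<mu> (\<lambda>\<zeta>. (f \<zeta>)\<^sup>2)"
    and D: "D \<ge> 0" "\<And>t. 0 < t \<Longrightarrow> t \<le> 1 \<Longrightarrow> (\<integral>\<omega>. (f (\<eta> t \<omega>) - f (\<eta> 0 \<omega>))\<^sup>2 \<partial>M) \<le> D * t"
    using assms unfolding mean_square_Lipschitz_def by blast
  have "(\<integral>\<omega>. (a * f (\<eta> t \<omega>) - a * f (\<eta> 0 \<omega>))\<^sup>2 \<partial>M) \<le> (a\<^sup>2 * D) * t" if "0 < t" "t \<le> 1" for t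
    using mult_left_mono[OF D(2)[OF that], of "a\<^sup>2"]
    by (simp add: power_mult_distrib mult.assoc flip: right_diff_distrib)
  then show ?thesis
    unfolding mean_square_Lipschitz_def using f D(1)
    by (intro conjI exI[of _ "a\<^sup>2 * D"] integrable_square_cmult) auto
qed

lemma mean_square_Lipschitz_add:
  assumes "mean_square_Lipschitz f" "mean_square_Lipschitz g"
  shows "mean_square_Lipschitz (\<lambda>\<zeta>. f \<zeta> + g \<zeta>)"
proof -
  obtain D where f: "f \<in> borel_measurable \<mu>" "integrable \<mu> (\<lambda>\<zeta>. (f \<zeta>)\<^sup>2)"
    and D: "D \<ge> 0" "\<And>t. 0 < t \<Longrightarrow> t \<le> 1 \<Longrightarrow> (\<integral>\<omega>. (f (\<eta> t \<omega>) - f (\<eta> 0 \<omega>))\<^sup>2 \<partial>M) \<le> D * t"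
    using assms(1) unfolding mean_square_Lipschitz_def by blast
  obtain D' where g: "g \<in> borel_measurable \<mu>" "integrable \<mu> (\<lambda>\<zeta>. (g \<zeta>)\<^sup>2)"
    and D': "D' \<ge> 0" "\<And>t. 0 < t \<Longrightarrow> t \<le> 1 \<Longrightarrow> (\<integral>\<omega>. (g (\<eta> t \<omega>) - g (\<eta> 0 \<omega>))\<^sup>2 \<partial>M) \<le> D' * t"
    using assms(2) unfolding mean_square_Lipschitz_def by blast
  note fg = borel_measurable_add[OF f(1) g(1)] integrable_square_add[OF f(1) g(1) f(2) g(2)]
  have "(\<integral>\<omega>. (f (\<eta> t \<omega>) + g (\<eta> t \<omega>) - (f (\<eta> 0 \<omega>) + g (\<eta> 0 \<omega>)))\<^sup>2 \<partial>M) \<le> (2 * D + 2 * D') * t"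
    if t: "0 < t" "t \<le> 1" for t
  proof -
    have i: "integrable M (\<lambda>\<omega>. (f (\<eta> t \<omega>) - f (\<eta> 0 \<omega>))\<^sup>2)" "integrable M (\<lambda>\<omega>. (g (\<eta> t \<omega>) - g (\<eta> 0 \<omega>))\<^sup>2)"
      "integrable M (\<lambda>\<omega>. (f (\<eta> t \<omega>) + g (\<eta> t \<omega>) - (f (\<eta> 0 \<omega>) + g (\<eta> 0 \<omega>)))\<^sup>2)"
      using integrable_increment[OF f, of t] integrable_increment[OF g, of t] integrable_increment[OF fg, of t] t by auto
    have "(a + b - (c + d))\<^sup>2 \<le> 2 * (a - c)\<^sup>2 + 2 * (b - d)\<^sup>2" for a b c d :: real
      using zero_le_power2[of "(a - c) - (b - d)"] by (simp add: power2_eq_square algebra_simps)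
    then have "(\<integral>\<omega>. (f (\<eta> t \<omega>) + g (\<eta> t \<omega>) - (f (\<eta> 0 \<omega>) + g (\<eta> 0 \<omega>)))\<^sup>2 \<partial>M)
      \<le> (\<integral>\<omega>. 2 * (f (\<eta> t \<omega>) - f (\<eta> 0 \<omega>))\<^sup>2 + 2 * (g (\<eta> t \<omega>) - g (\<eta> 0 \<omega>))\<^sup>2 \<partial>M)"
      using i by (intro integral_mono) auto
    also have "\<dots> \<le> 2 * (D * t) + 2 * (D' * t)" using i D(2)[OF t] D'(2)[OF t] by simp
    finally show ?thesis by (simp add: algebra_simps)
  qed
  then show ?thesis
    unfolding mean_square_Lipschitz_def using fg D(1) D'(1)
    by (intro conjI exI[of _ "2 * D + 2 * D'"]) auto
qed

lemma mean_square_Lipschitz_sum: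
  assumes "finite I" "\<And>i. i \<in> I \<Longrightarrow> mean_square_Lipschitz (f i)"
  shows "mean_square_Lipschitz (\<lambda>\<zeta>. \<Sum>i\<in>I. f i \<zeta>)"
  using assms
proof (induction I rule: finite_induct)
  case empty
  show ?case by (auto simp: mean_square_Lipschitz_def)
next
  case (insert i I)
  then show ?case using mean_square_Lipschitz_add[of "f i" "\<lambda>\<zeta>. \<Sum>i\<in>I. f i \<zeta>"] by simp
qed

lemma mean_square_Lipschitz_force:
  assumes "finite S"
  shows "mean_square_Lipschitz (\<lambda>\<zeta>. \<Sum>y\<in>S. q y * site_force V \<zeta> y)"
  unfolding site_force_eq_sum_neighbours
  using assms finite_neighbours
  by (intro mean_square_Lipschitz_sum mean_square_Lipschitz_cmult mean_square_Lipschitz_deriv)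
    (auto simp: mem_bonds_iff)

text \<open>The energy balance. Write \<open>X t = X 0 - A + sqrt 2 * N\<close> with drift \<open>A\<close> and noise \<open>N\<close>. As \<open>X 0\<close> and \<open>N\<close> are
  uncorrelated and \<open>X t\<close> has the same second moment as \<open>X 0\<close>, twice \<open>E[X 0 * A]\<close> equals
  the second moment of \<open>sqrt 2 * N - A\<close>. In short time, \<open>A\<close> is \<open>t * Q\<close> at time 0 up to an error \<open>R\<close> of mean square
  order \<open>t\<^sup>3\<close>. Dividing by \<open>t\<close> and letting \<open>t\<close> tend to 0 gives the bound.\<close>

lemma stationary_dissipation_le:
  assumes rep: "\<And>\<phi>. (\<Sum>b\<in>B. c b * grad \<phi> b) = (\<Sum>y\<in>S. q y * \<phi> y)"
    and B: "finite B" "B \<subseteq> bonds" and S: "finite S"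
  shows "(\<integral>\<zeta>. (\<Sum>b\<in>B. c b * \<zeta> b) * (\<Sum>y\<in>S. q y * site_force V \<zeta> y) \<partial>\<mu>) \<le> 2 * (\<Sum>y\<in>S. \<bar>q y\<bar>)\<^sup>2"
proof -
  define X where "X \<zeta> = (\<Sum>b\<in>B. c b * \<zeta> b)" for \<zeta>
  define Q where "Q \<zeta> = (\<Sum>y\<in>S. q y * site_force V \<zeta> y)" for \<zeta>
  define N where "N t \<omega> = (\<Sum>y\<in>S. q y * w t y \<omega>)" for t \<omega>
  define A where "A t \<omega> = X (\<eta> 0 \<omega>) - X (\<eta> t \<omega>) + sqrt 2 * N t \<omega>" for t \<omega>
  have X: "X \<in> borel_measurable \<mu>" "integrable \<mu> (\<lambda>\<zeta>. (X \<zeta>)\<^sup>2)"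
    unfolding X_def using B by (auto intro!: measurable_linear square_integrable_linear)
  have X1: "integrable \<mu> X" using \<mu>.square_integrable_imp_integrable[OF X] .
  have Q: "Q \<in> borel_measurable \<mu>" "integrable \<mu> (\<lambda>\<zeta>. (Q \<zeta>)\<^sup>2)"
    unfolding Q_def by (rule measurable_force, rule square_integrable_force[OF S])
  obtain D where "D \<ge> 0"
    and D: "\<And>t. 0 < t \<Longrightarrow> t \<le> 1 \<Longrightarrow> (\<integral>\<omega>. (Q (\<eta> t \<omega>) - Q (\<eta> 0 \<omega>))\<^sup>2 \<partial>M) \<le> D * t"
    using mean_square_Lipschitz_force[OF S, where q = q] unfolding mean_square_Lipschitz_def Q_def by blast
  define K where "K = (\<integral>\<zeta>. (Q \<zeta>)\<^sup>2 \<partial>\<mu>)"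
  define C where "C = ((\<integral>\<zeta>. (X \<zeta>)\<^sup>2 \<partial>\<mu>) + D) / 2"
  define E where "E = (\<integral>\<zeta>. X \<zeta> * Q \<zeta> \<partial>\<mu>)"
  let ?q = "(\<Sum>y\<in>S. \<bar>q y\<bar>)\<^sup>2"
  note X0 = measurable_observable[OF X(1), of 0, simplified] integrable_observable[OF X(2), of 0, simplified]
  note Q0 = measurable_observable[OF Q(1), of 0, simplified] integrable_observable[OF Q(2), of 0, simplified]
  have main: "E \<le> 2 * ?q + t * K + sqrt t * C" if t: "0 < t" "t \<le> 1" for t
  proof -
    note drift = drift_second_moment[OF rep B S t(1), folded X_def Q_def N_def, folded A_def K_def]
    note A = drift(1) drift(4,5)
    have N: "N t \<in> borel_measurable M" "integrable M (\<lambda>\<omega>. (N t \<omega>)\<^sup>2)" "(\<integral>\<omega>. (N t \<omega>)\<^sup>2 \<partial>M) \<le> ?q * t"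
      unfolding N_def using noise_second_moment[OF S t(1), of q] t
      by (auto intro!: borel_measurable_sum borel_measurable_times measurable_noise)
    have XN: "integrable M (\<lambda>\<omega>. X (\<eta> 0 \<omega>) * N t \<omega>)" "(\<integral>\<omega>. X (\<eta> 0 \<omega>) * N t \<omega> \<partial>M) = 0"
      unfolding N_def using noise_uncorrelated[OF X(1) X1 S t(1), of q] by auto
    have XA: "integrable M (\<lambda>\<omega>. X (\<eta> 0 \<omega>) * A t \<omega>)"
      by (rule integrable_mult_of_squares[OF X0(1) A(1) X0(2) A(2)])
    define R where "R \<omega> = A t \<omega> - t * Q (\<eta> 0 \<omega>)" for \<omega>
    have R: "integrable M (\<lambda>\<omega>. (R \<omega>)\<^sup>2)" "(\<integral>\<omega>. (R \<omega>)\<^sup>2 \<partial>M) \<le> t\<^sup>2 * (D * t)" and R_meas: "R \<in> borel_measurable M"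
    proof -
      show R_meas: "R \<in> borel_measurable M"
        unfolding R_def using A(1) Q0(1) by simp
      have AE: "AE \<omega> in M. R \<omega> = integral {0..t} (\<lambda>s. Q (\<eta> s \<omega>) - Q (\<eta> 0 \<omega>))"
        using drift(2,3)
      proof eventually_elim
        case (elim \<omega>)
        then show ?case
          using t by (subst integral_diff) (auto simp: R_def intro: integrable_continuous_interval)
      qed
      have cont: "AE \<omega> in M. continuous_on {0..t} (\<lambda>s. Q (\<eta> s \<omega>) - Q (\<eta> 0 \<omega>))"
        using drift(3) by eventually_elim (intro continuous_on_diff continuous_on_const)
      have le: "(\<integral>\<omega>. (Q (\<eta> s \<omega>) - Q (\<eta> 0 \<omega>))\<^sup>2 \<partial>M) \<le> D * t" if "0 \<le> s" "s \<le> t" for s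
      proof (cases "s = 0")
        case True
        then show ?thesis using \<open>D \<ge> 0\<close> t by simp
      next
        case False
        then have "(\<integral>\<omega>. (Q (\<eta> s \<omega>) - Q (\<eta> 0 \<omega>))\<^sup>2 \<partial>M) \<le> D * s" using that t by (intro D) auto
        also have "\<dots> \<le> D * t" using that \<open>D \<ge> 0\<close> by (intro mult_left_mono)
        finally show ?thesis .
      qed
      have m: "(\<lambda>\<omega>. Q (\<eta> s \<omega>) - Q (\<eta> 0 \<omega>)) \<in> borel_measurable M" if "0 \<le> s" for s
        using measurable_observable[OF Q(1) that] Q0(1) by simp
      show "integrable M (\<lambda>\<omega>. (R \<omega>)\<^sup>2)" "(\<integral>\<omega>. (R \<omega>)\<^sup>2 \<partial>M) \<le> t\<^sup>2 * (D * t)"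
        using path_integral_square_le[OF t(1) m integrable_increment[OF Q] le cont R_meas AE] by auto
    qed
    have "(\<integral>\<omega>. (X (\<eta> t \<omega>))\<^sup>2 \<partial>M) = (\<integral>\<omega>. (X (\<eta> 0 \<omega>))\<^sup>2 \<partial>M)"
      using integral_observable[of "\<lambda>\<zeta>. (X \<zeta>)\<^sup>2"] X(1) t by simp
    moreover have "(X (\<eta> t \<omega>))\<^sup>2 = (X (\<eta> 0 \<omega>))\<^sup>2 + (sqrt 2 * N t \<omega> - A t \<omega>)\<^sup>2
        + 2 * sqrt 2 * (X (\<eta> 0 \<omega>) * N t \<omega>) - 2 * (X (\<eta> 0 \<omega>) * A t \<omega>)" for \<omega>
    proof -
      have eq: "X (\<eta> t \<omega>) = X (\<eta> 0 \<omega>) + (sqrt 2 * N t \<omega> - A t \<omega>)" by (simp add: A_def)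
      show ?thesis unfolding eq power2_sum by (simp add: algebra_simps)
    qed
    moreover have NA: "integrable M (\<lambda>\<omega>. (sqrt 2 * N t \<omega> - A t \<omega>)\<^sup>2)"
      using N A by (intro integrable_square_diff integrable_square_cmult) auto
    ultimately have "2 * (\<integral>\<omega>. X (\<eta> 0 \<omega>) * A t \<omega> \<partial>M) = (\<integral>\<omega>. (sqrt 2 * N t \<omega> - A t \<omega>)\<^sup>2 \<partial>M)"
      using X0(2) XN XA by simp
    also have "\<dots> \<le> (\<integral>\<omega>. 4 * (N t \<omega>)\<^sup>2 + 2 * (A t \<omega>)\<^sup>2 \<partial>M)"
    proof (intro integral_mono NA)
      show "integrable M (\<lambda>\<omega>. 4 * (N t \<omega>)\<^sup>2 + 2 * (A t \<omega>)\<^sup>2)" using N A by simp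
      have "(u - v)\<^sup>2 \<le> 2 * u\<^sup>2 + 2 * v\<^sup>2" for u v :: real
        using zero_le_power2[of "u + v"] by (simp add: power2_eq_square algebra_simps)
      from this[of "sqrt 2 * N t _" "A t _"]
      show "(sqrt 2 * N t \<omega> - A t \<omega>)\<^sup>2 \<le> 4 * (N t \<omega>)\<^sup>2 + 2 * (A t \<omega>)\<^sup>2" for \<omega>
        by (simp add: power_mult_distrib)
    qed
    also have "\<dots> \<le> 4 * (?q * t) + 2 * (t\<^sup>2 * K)" using N A by simp
    finally have 1: "(\<integral>\<omega>. X (\<eta> 0 \<omega>) * A t \<omega> \<partial>M) \<le> 2 * (?q * t) + t\<^sup>2 * K" by simp
    have XQ: "integrable M (\<lambda>\<omega>. X (\<eta> 0 \<omega>) * Q (\<eta> 0 \<omega>))" "(\<integral>\<omega>. X (\<eta> 0 \<omega>) * Q (\<eta> 0 \<omega>) \<partial>M) = E"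
      unfolding E_def using integral_observable[of "\<lambda>\<zeta>. X \<zeta> * Q \<zeta>" 0] X(1) Q(1)
        integrable_mult_of_squares[OF X0(1) Q0(1) X0(2) Q0(2)] by auto
    have XR: "integrable M (\<lambda>\<omega>. X (\<eta> 0 \<omega>) * R \<omega>)"
      by (rule integrable_mult_of_squares[OF X0(1) R_meas X0(2) R(1)])
    have 2: "(\<integral>\<omega>. X (\<eta> 0 \<omega>) * A t \<omega> \<partial>M) = t * E + (\<integral>\<omega>. X (\<eta> 0 \<omega>) * R \<omega> \<partial>M)"
    proof -
      have "(\<integral>\<omega>. X (\<eta> 0 \<omega>) * A t \<omega> \<partial>M) = (\<integral>\<omega>. t * (X (\<eta> 0 \<omega>) * Q (\<eta> 0 \<omega>)) + X (\<eta> 0 \<omega>) * R \<omega> \<partial>M)"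
        by (intro Bochner_Integration.integral_cong refl) (simp add: R_def algebra_simps)
      also have "\<dots> = t * E + (\<integral>\<omega>. X (\<eta> 0 \<omega>) * R \<omega> \<partial>M)" using XQ XR by simp
      finally show ?thesis .
    qed
    \<comment> \<open>The weight for which both terms of Young's inequality are of order \<open>t * sqrt t\<close>.\<close>
    let ?a = "t * sqrt t"
    have a: "?a > 0" using t by simp
    have "\<bar>\<integral>\<omega>. X (\<eta> 0 \<omega>) * R \<omega> \<partial>M\<bar> \<le> ?a / 2 * (\<integral>\<omega>. (X (\<eta> 0 \<omega>))\<^sup>2 \<partial>M) + (\<integral>\<omega>. (R \<omega>)\<^sup>2 \<partial>M) / (2 * ?a)"
      by (rule integral_mult_le_weighted_squares[OF X0(1) R_meas X0(2) R(1) a])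
    also have "(\<integral>\<omega>. (X (\<eta> 0 \<omega>))\<^sup>2 \<partial>M) = (\<integral>\<zeta>. (X \<zeta>)\<^sup>2 \<partial>\<mu>)"
      using integral_observable[of "\<lambda>\<zeta>. (X \<zeta>)\<^sup>2" 0] X(1) by simp
    also have "(\<integral>\<omega>. (R \<omega>)\<^sup>2 \<partial>M) / (2 * ?a) \<le> t\<^sup>2 * (D * t) / (2 * ?a)"
      using R(2) a by (intro divide_right_mono) auto
    also have "t\<^sup>2 * (D * t) / (2 * ?a) = ?a / 2 * D"
    proof -
      have "t\<^sup>2 * t = ?a * ?a" using t by (simp add: power2_eq_square)
      then have eq: "t\<^sup>2 * (D * t) = D * (?a * ?a)" by (metis mult.assoc mult.commute)
      have "D * (x * x) / (2 * x) = x / 2 * D" if "x > 0" for x :: real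
        using that by (simp add: field_simps)
      from this[OF a] show ?thesis unfolding eq .
    qed
    finally have 3: "\<bar>\<integral>\<omega>. X (\<eta> 0 \<omega>) * R \<omega> \<partial>M\<bar> \<le> ?a * C" by (simp add: C_def algebra_simps add_divide_distrib)
    have "t * E \<le> t * (2 * ?q + t * K + sqrt t * C)"
      using 1 3 unfolding 2 by (simp add: algebra_simps power2_eq_square abs_le_iff)
    then show ?thesis using t by simp
  qed
  have "E \<le> 2 * ?q + 0 * K + sqrt 0 * C"
  proof (rule LIMSEQ_le_const)
    have l: "(\<lambda>n. 1 / real (Suc n)) \<longlonglongrightarrow> 0" by (rule LIMSEQ_Suc[OF lim_1_over_n])
    show "(\<lambda>n. 2 * ?q + 1 / real (Suc n) * K + sqrt (1 / real (Suc n)) * C) \<longlonglongrightarrow> 2 * ?q + 0 * K + sqrt 0 * C"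
      by (intro tendsto_intros l)
    show "\<exists>n0. \<forall>n\<ge>n0. E \<le> 2 * ?q + 1 / real (Suc n) * K + sqrt (1 / real (Suc n)) * C"
      by (intro exI allI impI main) auto
  qed
  then show ?thesis by (simp add: E_def X_def Q_def)
qed

end

section \<open>Translation invariance and the variance bound\<close>

text \<open>The stationary dynamics with a translation invariant law and an odd \<open>V'\<close>, as for every even \<open>V\<close>.\<close>

locale invariant_stationary_dynamics = stationary_dynamics V L r M w \<eta> \<mu>
  for V :: "real \<Rightarrow> real" and L r :: real and M :: "'w measure"
    and w :: "real \<Rightarrow> 'd::finite site \<Rightarrow> 'w \<Rightarrow> real"
    and \<eta> :: "real \<Rightarrow> 'w \<Rightarrow> 'd bond_field" and \<mu> :: "'d bond_field measure" +
  assumes invariant: "translation_invariant \<mu>"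
    and odd: "\<And>u. deriv V (- u) = - deriv V u"
begin

lemma space_law: "space \<mu> = gradient_fields"
  using sets_eq_imp_space_eq[OF sets_law] by (simp add: space_gradient_space)

lemma measurable_law_shift: "shift z \<in> \<mu> \<rightarrow>\<^sub>M \<mu>"
  using measurable_shift[of z] by (simp add: measurable_cong_sets[OF sets_law sets_law])

lemma distr_shift: "distr \<mu> \<mu> (shift z) = \<mu>"
proof -
  have "distr \<mu> \<mu> (shift z) = distr \<mu> gradient_space (shift z)"
    by (rule distr_cong) (simp_all add: sets_law)
  then show ?thesis using invariant by (simp add: translation_invariant_def)
qed

lemma integral_shift:
  fixes f :: "'d bond_field \<Rightarrow> real"
  assumes "f \<in> borel_measurable \<mu>"
  shows "(\<integral>\<zeta>. f (shift z \<zeta>) \<partial>\<mu>) = (\<integral>\<zeta>. f \<zeta> \<partial>\<mu>)"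
  using integral_distr[OF measurable_law_shift assms, of z] by (simp add: distr_shift)

lemma neighbour_bond: "e \<in> neighbours \<Longrightarrow> (y, y + e) \<in> bonds"
  by (simp add: mem_bonds_iff)

lemma measurable_weighted_bonds:
  assumes "e \<in> neighbours"
  shows "(\<lambda>\<zeta>. \<Sum>y\<in>S. q y * \<zeta> (y, y + e)) \<in> borel_measurable \<mu>"
    "(\<lambda>\<zeta>. \<Sum>y\<in>S. q y * deriv V (\<zeta> (y, y + e))) \<in> borel_measurable \<mu>"
  using neighbour_bond[OF assms]
  by (auto intro!: borel_measurable_sum borel_measurable_times measurable_law_bond measurable_law_deriv)

lemma square_integrable_weighted_bonds:
  assumes "e \<in> neighbours" "finite S"
  shows "integrable \<mu> (\<lambda>\<zeta>. (\<Sum>y\<in>S. q y * \<zeta> (y, y + e))\<^sup>2)"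
    "integrable \<mu> (\<lambda>\<zeta>. (\<Sum>y\<in>S. q y * deriv V (\<zeta> (y, y + e)))\<^sup>2)"
  using neighbour_bond[OF assms(1)] assms(2)
  by (auto intro!: integrable_square_sum integrable_square_cmult borel_measurable_times
      measurable_law_bond measurable_law_deriv square_integrable_bond square_integrable_deriv)

text \<open>Summation by parts. With \<open>W e\<close> the \<open>q\<close>-weighted sum of \<open>V'\<close> over the bonds in direction \<open>e\<close>, and \<open>Z e\<close>
  that of the bond variables, \<open>Q\<close> is the sum of the \<open>W e\<close>. By oddness \<open>W (- e)\<close> is minus
  a translate of \<open>W e\<close>; moving the translation to \<open>X\<close> turns \<open>X\<close> into \<open>X - Z e\<close>. Hence the terms
  of \<open>e\<close> and \<open>- e\<close> add up to \<open>E[W e * Z e]\<close>.\<close>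

lemma dissipation_eq:
  assumes rep: "\<And>\<phi>. (\<Sum>b\<in>B. c b * grad \<phi> b) = (\<Sum>y\<in>S. q y * \<phi> y)"
    and B: "finite B" "B \<subseteq> bonds" and S: "finite S"
  shows "(\<integral>\<zeta>. (\<Sum>b\<in>B. c b * \<zeta> b) * (\<Sum>y\<in>S. q y * site_force V \<zeta> y) \<partial>\<mu>)
    = (\<Sum>e\<in>neighbours. \<integral>\<zeta>. (\<Sum>y\<in>S. q y * deriv V (\<zeta> (y, y + e))) * (\<Sum>y\<in>S. q y * \<zeta> (y, y + e)) \<partial>\<mu>) / 2"
proof -
  define X where "X \<zeta> = (\<Sum>b\<in>B. c b * \<zeta> b)" for \<zeta>
  define W where "W e \<zeta> = (\<Sum>y\<in>S. q y * deriv V (\<zeta> (y, y + e)))" for e \<zeta>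
  define Z where "Z e \<zeta> = (\<Sum>y\<in>S. q y * \<zeta> (y, y + e))" for e and \<zeta> :: "'d bond_field"
  have X: "X \<in> borel_measurable \<mu>" "integrable \<mu> (\<lambda>\<zeta>. (X \<zeta>)\<^sup>2)"
    unfolding X_def using B by (auto intro!: measurable_linear square_integrable_linear)
  have W: "W e \<in> borel_measurable \<mu>" "integrable \<mu> (\<lambda>\<zeta>. (W e \<zeta>)\<^sup>2)"
    and Z: "Z e \<in> borel_measurable \<mu>" "integrable \<mu> (\<lambda>\<zeta>. (Z e \<zeta>)\<^sup>2)" if "e \<in> neighbours" for e
    unfolding W_def Z_def
    using measurable_weighted_bonds[OF that] square_integrable_weighted_bonds[OF that S] by auto
  have XW: "integrable \<mu> (\<lambda>\<zeta>. X \<zeta> * W e \<zeta>)" and ZW: "integrable \<mu> (\<lambda>\<zeta>. W e \<zeta> * Z e \<zeta>)"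
    if "e \<in> neighbours" for e
    using integrable_mult_of_squares[OF X(1) W(1) X(2) W(2)] integrable_mult_of_squares[OF W(1) Z(1) W(2) Z(2)] that
    by auto
  have force: "(\<Sum>y\<in>S. q y * site_force V \<zeta> y) = (\<Sum>e\<in>neighbours. W e \<zeta>)" for \<zeta>
    unfolding site_force_eq_sum_neighbours W_def by (simp add: sum_distrib_left sum.swap[of _ S])
  have refl_W: "W (- e) \<zeta> = - W e (shift (- e) \<zeta>)" if e: "e \<in> neighbours" and \<zeta>: "\<zeta> \<in> gradient_fields" for e \<zeta>
  proof -
    have "deriv V (\<zeta> (y, y + - e)) = - deriv V (shift (- e) \<zeta> (y, y + e))" for y
    proof -
      have "(y, y + - e) \<in> bonds" using e uminus_neighbours by (intro neighbour_bond) blast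
      from gradient_fields_antisym[OF \<zeta> this] show ?thesis
        using shift_bond[OF neighbour_bond[OF e, of y], of "- e" \<zeta>] odd by simp
    qed
    then show ?thesis by (simp add: W_def sum_negf)
  qed
  have shift_X: "X (shift e \<zeta>) = X \<zeta> - Z e \<zeta>" if e: "e \<in> neighbours" and \<zeta>: "\<zeta> \<in> gradient_fields" for e \<zeta>
  proof -
    obtain \<phi> where \<phi>: "\<zeta> = grad \<phi>" using \<zeta> by (auto simp: gradient_fields_def)
    have "X (shift e \<zeta>) = (\<Sum>y\<in>S. q y * \<phi> (y + e))" "X \<zeta> = (\<Sum>y\<in>S. q y * \<phi> y)"
      unfolding X_def \<phi> shift_grad rep by simp_all
    moreover have "Z e \<zeta> = (\<Sum>y\<in>S. q y * (\<phi> y - \<phi> (y + e)))"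
      unfolding Z_def \<phi> using neighbour_bond[OF e] by (simp add: grad_def)
    ultimately show ?thesis by (simp add: right_diff_distrib sum_subtractf)
  qed
  have pair: "(\<integral>\<zeta>. X \<zeta> * W e \<zeta> \<partial>\<mu>) + (\<integral>\<zeta>. X \<zeta> * W (- e) \<zeta> \<partial>\<mu>) = (\<integral>\<zeta>. W e \<zeta> * Z e \<zeta> \<partial>\<mu>)"
    if e: "e \<in> neighbours" for e
  proof -
    have "(\<integral>\<zeta>. X \<zeta> * W (- e) \<zeta> \<partial>\<mu>) = (\<integral>\<zeta>. - (X \<zeta> * W e (shift (- e) \<zeta>)) \<partial>\<mu>)"
      using refl_W[OF e] by (intro Bochner_Integration.integral_cong) (auto simp: space_law)
    also have "\<dots> = - (\<integral>\<zeta>. X \<zeta> * W e (shift (- e) \<zeta>) \<partial>\<mu>)" by simp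
    also have "(\<integral>\<zeta>. X \<zeta> * W e (shift (- e) \<zeta>) \<partial>\<mu>) = (\<integral>\<zeta>. X (shift e \<zeta>) * W e (shift (- e) (shift e \<zeta>)) \<partial>\<mu>)"
      using X(1) measurable_compose[OF measurable_law_shift W(1)[OF e]]
      by (intro integral_shift[symmetric, where f = "\<lambda>\<zeta>. X \<zeta> * W e (shift (- e) \<zeta>)"]) simp
    also have "\<dots> = (\<integral>\<zeta>. X \<zeta> * W e \<zeta> - W e \<zeta> * Z e \<zeta> \<partial>\<mu>)"
    proof (rule Bochner_Integration.integral_cong[OF refl])
      fix \<zeta> assume "\<zeta> \<in> space \<mu>"
      then have \<zeta>: "\<zeta> \<in> gradient_fields" by (simp add: space_law)
      have "shift (- e) (shift e \<zeta>) = \<zeta>" using \<zeta> by (auto simp: gradient_fields_def shift_grad)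
      then show "X (shift e \<zeta>) * W e (shift (- e) (shift e \<zeta>)) = X \<zeta> * W e \<zeta> - W e \<zeta> * Z e \<zeta>"
        by (simp add: shift_X[OF e \<zeta>] algebra_simps)
    qed
    also have "\<dots> = (\<integral>\<zeta>. X \<zeta> * W e \<zeta> \<partial>\<mu>) - (\<integral>\<zeta>. W e \<zeta> * Z e \<zeta> \<partial>\<mu>)"
      using XW[OF e] ZW[OF e] by simp
    finally show ?thesis by simp
  qed
  have bij: "bij_betw uminus neighbours (neighbours :: 'd site set)"
    by (rule bij_betwI[where g = uminus]) (auto simp flip: uminus_neighbours)
  have "(\<integral>\<zeta>. X \<zeta> * (\<Sum>e\<in>neighbours. W e \<zeta>) \<partial>\<mu>) = (\<Sum>e\<in>neighbours. \<integral>\<zeta>. X \<zeta> * W e \<zeta> \<partial>\<mu>)"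
    using XW by (simp add: sum_distrib_left)
  moreover have "(\<Sum>e\<in>neighbours. \<integral>\<zeta>. X \<zeta> * W e \<zeta> \<partial>\<mu>) = (\<Sum>e\<in>neighbours. \<integral>\<zeta>. X \<zeta> * W (- e) \<zeta> \<partial>\<mu>)"
    by (rule sum.reindex_bij_betw[OF bij, symmetric])
  moreover have "(\<Sum>e\<in>neighbours. \<integral>\<zeta>. X \<zeta> * W e \<zeta> \<partial>\<mu>) + (\<Sum>e\<in>neighbours. \<integral>\<zeta>. X \<zeta> * W (- e) \<zeta> \<partial>\<mu>)
    = (\<Sum>e\<in>neighbours. \<integral>\<zeta>. W e \<zeta> * Z e \<zeta> \<partial>\<mu>)"
    using pair by (simp flip: sum.distrib)
  ultimately have "2 * (\<integral>\<zeta>. X \<zeta> * (\<Sum>e\<in>neighbours. W e \<zeta>) \<partial>\<mu>) = (\<Sum>e\<in>neighbours. \<integral>\<zeta>. W e \<zeta> * Z e \<zeta> \<partial>\<mu>)"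
    by linarith
  then show ?thesis by (simp add: force flip: X_def W_def Z_def)
qed

text \<open>The weights are the point mass at 0 minus those of the mean ergodic theorem, applied to
  both families of centred fields at once, the forces and the bond variables.\<close>

lemma local_dissipation_le:
  assumes ergodic: "shift_ergodic \<mu>"
  defines "u \<equiv> \<lambda>e. \<integral>\<zeta>. \<zeta> (0, e) \<partial>\<mu>"
  shows "(\<Sum>e\<in>neighbours. \<integral>\<zeta>. (deriv V (\<zeta> (0, e)) - deriv V (u e)) * (\<zeta> (0, e) - u e) \<partial>\<mu>) \<le> 16"
proof -
  define v where "v e = (\<integral>\<zeta>. deriv V (\<zeta> (0, e)) \<partial>\<mu>)" for e
  \<comment> \<open>The flag \<open>i\<close> selects the centred force or the centred bond variable.\<close>
  define h :: "'d site \<times> bool \<Rightarrow> 'd bond_field \<Rightarrow> real"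
    where "h = (\<lambda>(e, i) \<zeta>. if i then deriv V (\<zeta> (0, e)) - v e else \<zeta> (0, e) - u e)"
  let ?N = "neighbours :: 'd site set"
  have bond: "(0, e) \<in> bonds" if "e \<in> ?N" for e using that by (simp add: mem_bonds_iff)
  have h: "h (e, i) \<in> borel_measurable \<mu>" "integrable \<mu> (\<lambda>\<zeta>. (h (e, i) \<zeta>)\<^sup>2)" "(\<integral>\<zeta>. h (e, i) \<zeta> \<partial>\<mu>) = 0"
    if e: "e \<in> ?N" for e i
  proof -
    note b = measurable_law_bond[OF bond[OF e]] square_integrable_bond[OF bond[OF e]]
    note d = measurable_law_deriv[OF bond[OF e]] square_integrable_deriv[OF bond[OF e]]
    show "h (e, i) \<in> borel_measurable \<mu>" unfolding h_def using b(1) d(1) by (cases i) auto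
    show "integrable \<mu> (\<lambda>\<zeta>. (h (e, i) \<zeta>)\<^sup>2)"
      unfolding h_def using b d by (cases i) (auto intro!: integrable_square_diff)
    show "(\<integral>\<zeta>. h (e, i) \<zeta> \<partial>\<mu>) = 0"
      using \<mu>.square_integrable_imp_integrable[OF b] \<mu>.square_integrable_imp_integrable[OF d]
      by (cases i) (simp_all add: h_def u_def v_def \<mu>.prob_space)
  qed
  define E where "E = (\<Sum>e\<in>?N. \<integral>\<zeta>. h (e, True) \<zeta> * h (e, False) \<zeta> \<partial>\<mu>)"
  define D where "D = (\<Sum>e\<in>?N. ((\<integral>\<zeta>. (h (e, True) \<zeta>)\<^sup>2 \<partial>\<mu>) + (\<integral>\<zeta>. (h (e, False) \<zeta>)\<^sup>2 \<partial>\<mu>)) / 2 + 2)"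
  have main: "E \<le> 16 + \<delta> * D" if \<delta>: "0 < \<delta>" "\<delta> \<le> 1" for \<delta>
  proof -
    obtain S :: "'d site set" and p where S: "finite S" and p: "\<And>z. p z \<ge> 0" "\<And>z. z \<notin> S \<Longrightarrow> p z = 0" "(\<Sum>z\<in>S. p z) = 1"
      and small: "\<And>j. j \<in> ?N \<times> UNIV \<Longrightarrow> (\<integral>\<zeta>. (\<Sum>z\<in>S. p z * h j (shift z \<zeta>))\<^sup>2 \<partial>\<mu>) \<le> \<delta>\<^sup>2"
    proof (rule mean_ergodic_averages[OF \<mu>.prob_space_axioms measurable_law_shift distr_shift, where J = "?N \<times> UNIV" and h = h and \<epsilon> = "\<delta>\<^sup>2"])
      show "measure \<mu> A = 0 \<or> measure \<mu> A = 1"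
        if "A \<in> sets \<mu>" "\<And>z. shift z -` A \<inter> space \<mu> = A" for A
        using ergodic that unfolding shift_ergodic_def by blast
    qed (use h \<delta> finite_neighbours in \<open>auto simp: space_law shift_shift\<close>)
    define S' where "S' = insert 0 S"
    define q where "q y = (if y = 0 then 1 else 0) - p y" for y
    have S': "finite S'" using S by (simp add: S'_def)
    have ext: "(\<Sum>y\<in>S'. p y * f y) = (\<Sum>y\<in>S. p y * f y)" for f
      unfolding S'_def using S p by (intro sum.mono_neutral_right) auto
    have q_sum: "(\<Sum>y\<in>S'. q y * f y) = f 0 - (\<Sum>y\<in>S. p y * f y)" for f
    proof -
      have "(\<Sum>y\<in>S'. q y * f y) = (\<Sum>y\<in>S'. if y = 0 then f y else 0) - (\<Sum>y\<in>S'. p y * f y)"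
        unfolding q_def sum_subtractf[symmetric] by (intro sum.cong) (auto simp: left_diff_distrib)
      then show ?thesis using S' by (simp add: ext sum.delta') (simp add: S'_def)
    qed
    have q_zero: "(\<Sum>y\<in>S'. q y) = 0" using q_sum[of "\<lambda>_. 1"] p by simp
    have "(\<Sum>y\<in>S'. \<bar>q y\<bar>) \<le> (\<Sum>y\<in>S'. (if y = 0 then 1 else 0) + p y)"
      unfolding q_def using p by (intro sum_mono) (auto simp: abs_le_iff)
    also have "\<dots> = 2" using S' ext[of "\<lambda>_. 1"] p by (simp add: sum.distrib) (simp add: S'_def)
    finally have q_abs: "(\<Sum>y\<in>S'. \<bar>q y\<bar>) \<le> 2" .
    obtain B c where B: "finite B" "B \<subseteq> bonds" and rep: "\<And>\<phi>. (\<Sum>b\<in>B. c b * grad \<phi> b) = (\<Sum>y\<in>S'. q y * \<phi> y)"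
      using gradient_functional_weighted[OF S' q_zero] unfolding gradient_functional_def by metis
    define W where "W e \<zeta> = (\<Sum>y\<in>S'. q y * deriv V (\<zeta> (y, y + e)))" for e \<zeta>
    define Z where "Z e \<zeta> = (\<Sum>y\<in>S'. q y * \<zeta> (y, y + e))" for e and \<zeta> :: "'d bond_field"
    have "(\<Sum>e\<in>?N. \<integral>\<zeta>. W e \<zeta> * Z e \<zeta> \<partial>\<mu>) / 2 \<le> 2 * (\<Sum>y\<in>S'. \<bar>q y\<bar>)\<^sup>2"
      unfolding W_def Z_def dissipation_eq[OF rep B S', symmetric] by (rule stationary_dissipation_le[OF rep B S'])
    also have "\<dots> \<le> 2 * 2\<^sup>2" using q_abs by (intro mult_left_mono power_mono) (auto intro: sum_nonneg)
    finally have le16: "(\<Sum>e\<in>?N. \<integral>\<zeta>. W e \<zeta> * Z e \<zeta> \<partial>\<mu>) \<le> 16" by simp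
    have "(\<integral>\<zeta>. h (e, True) \<zeta> * h (e, False) \<zeta> \<partial>\<mu>)
      \<le> (\<integral>\<zeta>. W e \<zeta> * Z e \<zeta> \<partial>\<mu>) + \<delta> * (((\<integral>\<zeta>. (h (e, True) \<zeta>)\<^sup>2 \<partial>\<mu>) + (\<integral>\<zeta>. (h (e, False) \<zeta>)\<^sup>2 \<partial>\<mu>)) / 2 + 2)"
      if e: "e \<in> ?N" for e
    proof -
      define av where "av i \<zeta> = (\<Sum>z\<in>S. p z * h (e, i) (shift z \<zeta>))" for i \<zeta>
      have sh: "(\<lambda>\<zeta>. h (e, i) (shift z \<zeta>)) \<in> borel_measurable \<mu>" for i z
        using measurable_compose[OF measurable_law_shift h(1)[OF e]] .
      have sh2: "integrable \<mu> (\<lambda>\<zeta>. (h (e, i) (shift z \<zeta>))\<^sup>2)" for i z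
        using integrable_distr[OF measurable_law_shift, of z "\<lambda>\<zeta>. (h (e, i) \<zeta>)\<^sup>2"] h(2)[OF e] by (simp add: distr_shift)
      have av: "av i \<in> borel_measurable \<mu>" "integrable \<mu> (\<lambda>\<zeta>. (av i \<zeta>)\<^sup>2)" "(\<integral>\<zeta>. (av i \<zeta>)\<^sup>2 \<partial>\<mu>) \<le> \<delta>\<^sup>2" for i
        unfolding av_def using sh sh2 S small[of "(e, i)"] e
        by (auto intro!: integrable_square_sum integrable_square_cmult borel_measurable_sum borel_measurable_times)
      have pos: "shift y \<zeta> (0, e) = \<zeta> (y, y + e)" for y \<zeta>
        using shift_bond[OF bond[OF e], of y \<zeta>] by (simp add: add.commute)
      have W: "W e \<zeta> = h (e, True) \<zeta> - av True \<zeta>" for \<zeta>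
      proof -
        have "W e \<zeta> = (\<Sum>y\<in>S'. q y * (deriv V (\<zeta> (y, y + e)) - v e))"
          using q_zero by (simp add: W_def right_diff_distrib sum_subtractf flip: sum_distrib_right)
        then show ?thesis unfolding q_sum by (simp add: h_def av_def pos)
      qed
      have Z: "Z e \<zeta> = h (e, False) \<zeta> - av False \<zeta>" for \<zeta>
      proof -
        have "Z e \<zeta> = (\<Sum>y\<in>S'. q y * (\<zeta> (y, y + e) - u e))"
          using q_zero by (simp add: Z_def right_diff_distrib sum_subtractf flip: sum_distrib_right)
        then show ?thesis unfolding q_sum by (simp add: h_def av_def pos)
      qed
      note i = integrable_mult_of_squares[OF h(1) h(1) h(2) h(2), OF e e e e, of True False]
        integrable_mult_of_squares[OF h(1) av(1) h(2) av(2), OF e e, of True False]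
        integrable_mult_of_squares[OF h(1) av(1) h(2) av(2), OF e e, of False True]
        integrable_mult_of_squares[OF av(1) av(1) av(2) av(2), of True False]
      have "(\<integral>\<zeta>. W e \<zeta> * Z e \<zeta> \<partial>\<mu>) = (\<integral>\<zeta>. h (e, True) \<zeta> * h (e, False) \<zeta> - h (e, True) \<zeta> * av False \<zeta>
          - h (e, False) \<zeta> * av True \<zeta> + av True \<zeta> * av False \<zeta> \<partial>\<mu>)"
        unfolding W Z by (intro Bochner_Integration.integral_cong refl) (simp add: algebra_simps)
      also have "\<dots> = (\<integral>\<zeta>. h (e, True) \<zeta> * h (e, False) \<zeta> \<partial>\<mu>) - (\<integral>\<zeta>. h (e, True) \<zeta> * av False \<zeta> \<partial>\<mu>)
          - (\<integral>\<zeta>. h (e, False) \<zeta> * av True \<zeta> \<partial>\<mu>) + (\<integral>\<zeta>. av True \<zeta> * av False \<zeta> \<partial>\<mu>)"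
        using i by simp
      finally have split: "(\<integral>\<zeta>. W e \<zeta> * Z e \<zeta> \<partial>\<mu>) = \<dots>" .
      have cross: "\<bar>\<integral>\<zeta>. h (e, k) \<zeta> * av l \<zeta> \<partial>\<mu>\<bar> \<le> \<delta> / 2 * (\<integral>\<zeta>. (h (e, k) \<zeta>)\<^sup>2 \<partial>\<mu>) + \<delta> / 2" for k l
      proof -
        have "(\<integral>\<zeta>. (av l \<zeta>)\<^sup>2 \<partial>\<mu>) / (2 * \<delta>) \<le> \<delta>\<^sup>2 / (2 * \<delta>)"
          using av(3) \<delta> by (intro divide_right_mono) auto
        also have "\<dots> = \<delta> / 2" using \<delta> by (simp add: power2_eq_square)
        finally show ?thesis
          using integral_mult_le_weighted_squares[OF h(1)[OF e] av(1) h(2)[OF e] av(2) \<delta>(1), of k l] by linarith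
      qed
      have "\<bar>\<integral>\<zeta>. av True \<zeta> * av False \<zeta> \<partial>\<mu>\<bar> \<le> 1 / 2 * (\<integral>\<zeta>. (av True \<zeta>)\<^sup>2 \<partial>\<mu>) + (\<integral>\<zeta>. (av False \<zeta>)\<^sup>2 \<partial>\<mu>) / (2 * 1)"
        by (rule integral_mult_le_weighted_squares[OF av(1) av(1) av(2) av(2)]) simp
      also have "\<dots> \<le> 1 / 2 * \<delta>\<^sup>2 + \<delta>\<^sup>2 / (2 * 1)"
        using av(3)[of True] av(3)[of False] by (intro add_mono mult_left_mono divide_right_mono) auto
      also have "\<dots> \<le> \<delta>" using \<delta> by (simp add: power2_eq_square mult_left_le)
      finally show ?thesis using cross[of True False] cross[of False True] unfolding split
        by (simp add: abs_le_iff algebra_simps add_divide_distrib)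
    qed
    then have "E \<le> (\<Sum>e\<in>?N. (\<integral>\<zeta>. W e \<zeta> * Z e \<zeta> \<partial>\<mu>)
        + \<delta> * (((\<integral>\<zeta>. (h (e, True) \<zeta>)\<^sup>2 \<partial>\<mu>) + (\<integral>\<zeta>. (h (e, False) \<zeta>)\<^sup>2 \<partial>\<mu>)) / 2 + 2))"
      unfolding E_def by (rule sum_mono)
    also have "\<dots> = (\<Sum>e\<in>?N. \<integral>\<zeta>. W e \<zeta> * Z e \<zeta> \<partial>\<mu>) + \<delta> * D"
      unfolding D_def sum_distrib_left by (rule sum.distrib)
    also have "\<dots> \<le> 16 + \<delta> * D" using le16 by simp
    finally show ?thesis .
  qed
  have "E \<le> 16 + 0 * D"
  proof (rule LIMSEQ_le_const)
    have l: "(\<lambda>n. 1 / real (Suc n)) \<longlonglongrightarrow> 0" by (rule LIMSEQ_Suc[OF lim_1_over_n])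
    show "(\<lambda>n. 16 + 1 / real (Suc n) * D) \<longlonglongrightarrow> 16 + 0 * D" by (intro tendsto_intros l)
    show "\<exists>n0. \<forall>n\<ge>n0. E \<le> 16 + 1 / real (Suc n) * D" by (intro exI allI impI main) auto
  qed
  moreover have "(\<integral>\<zeta>. (deriv V (\<zeta> (0, e)) - deriv V (u e)) * (\<zeta> (0, e) - u e) \<partial>\<mu>)
      = (\<integral>\<zeta>. h (e, True) \<zeta> * h (e, False) \<zeta> \<partial>\<mu>)" if e: "e \<in> ?N" for e
  proof -
    have "(\<integral>\<zeta>. (deriv V (\<zeta> (0, e)) - deriv V (u e)) * (\<zeta> (0, e) - u e) \<partial>\<mu>)
      = (\<integral>\<zeta>. h (e, True) \<zeta> * h (e, False) \<zeta> + (v e - deriv V (u e)) * h (e, False) \<zeta> \<partial>\<mu>)"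
      by (intro Bochner_Integration.integral_cong refl) (simp add: h_def algebra_simps)
    also have "\<dots> = (\<integral>\<zeta>. h (e, True) \<zeta> * h (e, False) \<zeta> \<partial>\<mu>) + (v e - deriv V (u e)) * (\<integral>\<zeta>. h (e, False) \<zeta> \<partial>\<mu>)"
      using integrable_mult_of_squares[OF h(1) h(1) h(2) h(2), OF e e e e, of True False]
        \<mu>.square_integrable_imp_integrable[OF h(1,2)[OF e]] by simp
    finally show ?thesis using h(3)[OF e] by simp
  qed
  ultimately show ?thesis by (simp add: E_def)
qed

text \<open>The bound depends on the potential and the dimension only, not on \<open>\<mu>\<close>: Young's inequality
  absorbs the linear term of the monotonicity estimate, at any mean.\<close>

lemma variance_bond_le:
  assumes ergodic: "shift_ergodic \<mu>" and "c > 0" "C > 0"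
    and mono: "\<And>s t. (deriv V s - deriv V t) * (s - t) \<ge> c * (s - t)\<^sup>2 - 2 * C * \<bar>s - t\<bar>"
    and b: "b \<in> bonds"
  shows "\<mu>.variance (\<lambda>\<zeta>. \<zeta> b) \<le> 2 / c * (16 + real (card (neighbours :: 'd site set)) * (2 * C\<^sup>2 / c))"
proof -
  let ?N = "neighbours :: 'd site set"
  define u where "u e = (\<integral>\<zeta>. \<zeta> (0, e) \<partial>\<mu>)" for e
  define s where "s e = (\<integral>\<zeta>. (\<zeta> (0, e) - u e)\<^sup>2 \<partial>\<mu>)" for e
  have bond: "(0, e) \<in> bonds" if "e \<in> ?N" for e using that by (simp add: mem_bonds_iff)
  have young: "(deriv V x - deriv V y) * (x - y) \<ge> c / 2 * (x - y)\<^sup>2 - 2 * C\<^sup>2 / c" for x y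
  proof -
    have "0 \<le> (c * \<bar>x - y\<bar> - 2 * C)\<^sup>2" by simp
    then have "4 * C * (c * \<bar>x - y\<bar>) \<le> c\<^sup>2 * (x - y)\<^sup>2 + 4 * C\<^sup>2" by (simp add: power2_diff power_mult_distrib mult_ac)
    then have "2 * C * \<bar>x - y\<bar> \<le> c / 2 * (x - y)\<^sup>2 + 2 * C\<^sup>2 / c"
      using \<open>c > 0\<close> by (simp add: field_simps power2_eq_square)
    then show ?thesis using mono[of x y] by linarith
  qed
  have lower: "c / 2 * s e - 2 * C\<^sup>2 / c
      \<le> (\<integral>\<zeta>. (deriv V (\<zeta> (0, e)) - deriv V (u e)) * (\<zeta> (0, e) - u e) \<partial>\<mu>)" if e: "e \<in> ?N" for e
  proof -
    note m = measurable_law_bond[OF bond[OF e]] measurable_law_deriv[OF bond[OF e]]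
    have i: "integrable \<mu> (\<lambda>\<zeta>. (\<zeta> (0, e) - u e)\<^sup>2)" "integrable \<mu> (\<lambda>\<zeta>. (deriv V (\<zeta> (0, e)) - deriv V (u e))\<^sup>2)"
      using m square_integrable_bond[OF bond[OF e]] square_integrable_deriv[OF bond[OF e]]
      by (auto intro!: integrable_square_diff)
    have "c / 2 * s e - 2 * C\<^sup>2 / c = (\<integral>\<zeta>. c / 2 * (\<zeta> (0, e) - u e)\<^sup>2 - 2 * C\<^sup>2 / c \<partial>\<mu>)"
      using i by (simp add: s_def \<mu>.prob_space)
    also have "\<dots> \<le> (\<integral>\<zeta>. (deriv V (\<zeta> (0, e)) - deriv V (u e)) * (\<zeta> (0, e) - u e) \<partial>\<mu>)"
      using i m young by (intro integral_mono integrable_mult_of_squares) auto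
    finally show ?thesis .
  qed
  have s_nonneg: "s e \<ge> 0" for e by (simp add: s_def)
  obtain x y where xy: "b = (x, y)" by (cases b)
  define e where "e = y - x"
  have e: "e \<in> ?N" using b by (simp add: xy e_def mem_bonds_iff)
  have "(\<Sum>e\<in>?N. c / 2 * s e - 2 * C\<^sup>2 / c) \<le> 16"
    by (rule order_trans[OF sum_mono[OF lower]]) (use local_dissipation_le[OF ergodic] in \<open>simp_all add: u_def\<close>)
  then have "c / 2 * (\<Sum>e\<in>?N. s e) \<le> 16 + real (card ?N) * (2 * C\<^sup>2 / c)"
    by (simp add: sum_subtractf sum_distrib_left)
  moreover have "s e \<le> (\<Sum>e\<in>?N. s e)" using e finite_neighbours s_nonneg by (intro member_le_sum) auto
  then have "c / 2 * s e \<le> c / 2 * (\<Sum>e\<in>?N. s e)" using \<open>c > 0\<close> by (intro mult_left_mono) auto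
  ultimately have "c / 2 * s e \<le> 16 + real (card ?N) * (2 * C\<^sup>2 / c)" by linarith
  then have "2 / c * (c / 2 * s e) \<le> 2 / c * (16 + real (card ?N) * (2 * C\<^sup>2 / c))"
    using \<open>c > 0\<close> by (intro mult_left_mono) auto
  moreover have "2 / c * (c / 2 * s e) = s e" using \<open>c > 0\<close> by simp
  moreover have "\<mu>.variance (\<lambda>\<zeta>. \<zeta> b) = s e"
  proof -
    have pos: "shift x \<zeta> (0, e) = \<zeta> b" for \<zeta>
      using shift_bond[OF bond[OF e], of x \<zeta>] by (simp add: xy e_def)
    note m = measurable_law_bond[OF bond[OF e]]
    have mean: "(\<integral>\<zeta>. \<zeta> b \<partial>\<mu>) = u e"
      using integral_shift[OF m, of x] by (simp add: pos u_def)
    show ?thesis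
      using integral_shift[of "\<lambda>\<zeta>. (\<zeta> (0, e) - u e)\<^sup>2" x] m by (simp add: pos mean s_def)
  qed
  ultimately show ?thesis by (simp only:)
qed

end

theorem theorem3p2:
  fixes V :: "real \<Rightarrow> real" and b :: "'d::finite bond"
  assumes "assumption_A V" and "b \<in> bonds"
  shows "(SUP \<mu>\<in>S_ext V. ereal (prob_space.variance \<mu> (\<lambda>\<eta>. \<eta> b))) < \<infinity>"
proof (rule potential_derivative[OF assms(1)])
  fix c C L :: real
  assume "c > 0" "C > 0" "L > 0"
    and V: "\<And>u. deriv V (- u) = - deriv V u" "\<And>s t. \<bar>deriv V s - deriv V t\<bar> \<le> L * \<bar>s - t\<bar>"
    and mono: "\<And>s t. (deriv V s - deriv V t) * (s - t) \<ge> c * (s - t)\<^sup>2 - 2 * C * \<bar>s - t\<bar>"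
  define K where "K = 2 / c * (16 + real (card (neighbours :: 'd site set)) * (2 * C\<^sup>2 / c))"
  have "prob_space.variance \<mu> (\<lambda>\<eta>. \<eta> b) \<le> K" if \<mu>: "\<mu> \<in> S_ext V" for \<mu> :: "'d bond_field measure"
  proof -
    obtain r and M :: "((real \<Rightarrow> 'd site \<Rightarrow> real) \<times> (real \<Rightarrow> 'd bond_field)) measure" and w \<eta>
      where "gradient_sde_solution V r M w \<eta>" "\<forall>t\<ge>0. distr M gradient_space (\<eta> t) = \<mu>"
      using \<mu> unfolding S_ext_def stationary_measure_def by blast
    then interpret invariant_stationary_dynamics V L r M w \<eta> \<mu>
      by unfold_locales (use \<mu> V in \<open>auto simp: S_ext_def\<close>)
    have "shift_ergodic \<mu>" using \<mu> by (simp add: S_ext_def)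
    from variance_bond_le[OF this \<open>c > 0\<close> \<open>C > 0\<close> mono assms(2)] show ?thesis
      unfolding K_def .
  qed
  then have "(SUP \<mu>\<in>S_ext V. ereal (prob_space.variance \<mu> (\<lambda>\<eta>. \<eta> b))) \<le> ereal K"
    by (intro SUP_least) simp
  then show ?thesis by (rule le_less_trans) simp
qed

end
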